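(* Let $d\in\mathbb{N}$, let $Z$ be a zero-mean Gaussian process on $\mathbb{R}^d$ with stationary covariance function $k_Z$ that is sub-exponential and asymptotically positive, let $T:\mathbb{R}\to\mathbb{R}$ be sub-exponential and non-decreasing, and let $Y(s)=T(Z(s))$, $s\in\mathbb{R}^d$, be assumed to have zero mean, with stationary covariance function $k_Y$. Let $(s_i)_{i\in\mathbb{N}}$ be an asymptotically well-separated sequence in $\mathbb{R}^d$, and for $n\in\mathbb{N}$ let $R=(k_Y(s_i-s_j))_{i,j=1,\ldots,n}$. Then for every fixed $0<\tau<\infty$ there is a constant $C<\infty$, depending on $\tau$ but not on $n,i,j$, such that for all $n\in\mathbb{N}$ and all $i,j=1,\ldots,n$, \[ \left|\left(R^{-1}\right)_{i,j}\right|\le \frac{C}{1+|s_i-s_j|^{d+\tau}} . \]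
   Context: $\mathbb{N}$ is the set of positive integers, and $|x|=\max_{i}|x_i|$ for a vector $x$. A function $k:\mathbb{R}^d\to\mathbb{R}$ is called a stationary covariance function if $(x_1,x_2)\mapsto k(x_1-x_2)$ is a covariance function. A sequence $(x_i)_{i\in\mathbb{N}}$ in $\mathbb{R}^d$ is asymptotically well-separated if $\inf_{i\neq j}|x_i-x_j|>0$. A stationary covariance function $k$ on $\mathbb{R}^d$ is sub-exponential and asymptotically positive if: (i) there are constants $C<\infty$, $c>0$ with $|k(s)|\le C\exp(-c|s|)$ for all $s\in\mathbb{R}^d$; (ii) for any asymptotically well-separated sequence $(x_i)_{i\in\mathbb{N}}$, the smallest eigenvalue of the $n\times n$ matrix $(k(x_i-x_j))_{i,j=1,\ldots,n}$ is bounded below by a strictly positive constant uniformly in $n\in\mathbb{N}$. A function $F:\mathbb{R}\to\mathbb{R}$ is sub-exponential and non-decreasing if it is non-constant, continuously differentiable, non-decreasing, and there is a constant $C<\infty$ with $|F(t)|\le C\exp(C|t|)$ and $|F'(t)|\le C\exp(C|t|)$ for all $t\in\mathbb{R}$. *)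

theory Defs
  imports
    "HOL-Probability.Probability"
    "Jordan_Normal_Form.Gauss_Jordan_Elimination"
    "Jordan_Normal_Form.Spectral_Radius"
begin

text \<open>
  The norm on \<open>real ^ 'd\<close> is the maximum norm \<open>infnorm\<close>. Sequences are indexed by \<open>nat\<close> from 0,
  so that an \<open>n \<times> n\<close> matrix uses the first \<open>n\<close> points, with indices below \<open>n\<close>.
\<close>

definition well_separated :: "(nat \<Rightarrow> real ^ 'd) \<Rightarrow> bool" where
  "well_separated x \<longleftrightarrow> 0 < (INF (i, j) \<in> {(i, j). i \<noteq> j}. infnorm (x i - x j))"

definition cov_mat :: "(real ^ 'd \<Rightarrow> real) \<Rightarrow> (nat \<Rightarrow> real ^ 'd) \<Rightarrow> nat \<Rightarrow> real mat" where
  "cov_mat k x n = Matrix.mat n n (\<lambda>(i, j). k (x i - x j))"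

text \<open>
  Meaningful when all eigenvalues of \<open>A\<close> are real and there is at least one, in particular for
  symmetric \<open>A\<close> of positive dimension.
\<close>

definition smallest_eigenvalue :: "real mat \<Rightarrow> real" where
  "smallest_eigenvalue A = Min (spectrum A)"

text \<open>
  This is a property of stationary covariance functions. That \<open>k\<close> is one is not part of the
  definition: it is expressed by \<open>has_stationary_covariance\<close> below, for a given process.
\<close>

definition subexp_asymp_pos :: "(real ^ 'd \<Rightarrow> real) \<Rightarrow> bool" where
  "subexp_asymp_pos k \<longleftrightarrow>
     (\<exists>C c. c > 0 \<and> (\<forall>s. \<bar>k s\<bar> \<le> C * exp (- c * infnorm s))) \<and>
     (\<forall>x. well_separated x \<longrightarrow>
        (\<exists>\<delta>>0. \<forall>n\<ge>1. \<delta> \<le> smallest_eigenvalue (cov_mat k x n)))"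

definition subexp_nondecreasing :: "(real \<Rightarrow> real) \<Rightarrow> bool" where
  "subexp_nondecreasing F \<longleftrightarrow>
     \<not> F constant_on UNIV \<and>
     F differentiable_on UNIV \<and> continuous_on UNIV (deriv F) \<and>
     mono F \<and>
     (\<exists>C. \<forall>t. \<bar>F t\<bar> \<le> C * exp (C * \<bar>t\<bar>) \<and> \<bar>deriv F t\<bar> \<le> C * exp (C * \<bar>t\<bar>))"

text \<open>Almost surely constant variables count as Gaussian, with variance zero.\<close>

definition gaussian_rv :: "'w measure \<Rightarrow> ('w \<Rightarrow> real) \<Rightarrow> bool" where
  "gaussian_rv M X \<longleftrightarrow> X \<in> borel_measurable M \<and>
     (\<exists>\<mu>. (AE \<omega> in M. X \<omega> = \<mu>) \<or>
          (\<exists>\<sigma>>0. distributed M lborel X (\<lambda>x. ennreal (normal_density \<mu> \<sigma> x))))"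

definition gaussian_process :: "'w measure \<Rightarrow> ('i \<Rightarrow> 'w \<Rightarrow> real) \<Rightarrow> bool" where
  "gaussian_process M Z \<longleftrightarrow>
     (\<forall>S a. finite S \<longrightarrow> gaussian_rv M (\<lambda>\<omega>. \<Sum>s\<in>S. a s * Z s \<omega>))"

definition zero_mean :: "'w measure \<Rightarrow> ('i \<Rightarrow> 'w \<Rightarrow> real) \<Rightarrow> bool" where
  "zero_mean M Z \<longleftrightarrow> (\<forall>s. integrable M (Z s) \<and> integral\<^sup>L M (Z s) = 0)"

definition covariance :: "'w measure \<Rightarrow> ('w \<Rightarrow> real) \<Rightarrow> ('w \<Rightarrow> real) \<Rightarrow> real" where
  "covariance M X Y =
     integral\<^sup>L M (\<lambda>\<omega>. (X \<omega> - integral\<^sup>L M X) * (Y \<omega> - integral\<^sup>L M Y))"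

definition has_stationary_covariance ::
  "'w measure \<Rightarrow> (real ^ 'd \<Rightarrow> 'w \<Rightarrow> real) \<Rightarrow> (real ^ 'd \<Rightarrow> real) \<Rightarrow> bool" where
  "has_stationary_covariance M Z k \<longleftrightarrow>
     (\<forall>s. Z s \<in> borel_measurable M \<and> integrable M (\<lambda>\<omega>. (Z s \<omega>)\<^sup>2)) \<and>
     (\<forall>s t. covariance M (Z s) (Z t) = k (s - t))"

end

theory Submission
  imports Defs
begin

text \<open>
  The covariance matrix \<open>R\<close> of the transformed process inherits two properties from the Gaussian
  process, and they force its inverse to decay even exponentially off the diagonal.

  \<^item> Decay of \<open>k\<^sub>Y\<close>. For \<open>X = Z u\<close> and \<open>V = Z 0\<close>, regression gives \<open>V = \<rho> X + W\<close> with \<open>W\<close> independent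
  of \<open>X\<close> and \<open>\<rho>\<close> proportional to \<open>k\<^sub>Z u\<close>. As \<open>T X\<close> has mean zero, \<open>E (T X * T W) = 0\<close>, hence
  \<open>k\<^sub>Y u = E (T X * (T (W + \<rho> X) - T W))\<close>. By the mean value theorem the increment of \<open>T\<close> is at
  most \<open>\<bar>\<rho> X\<bar>\<close> times an exponential, and exponentials of Gaussian variables have finite mean.
  So \<open>\<bar>k\<^sub>Y\<bar>\<close> is at most a constant times \<open>\<bar>k\<^sub>Z\<bar>\<close> (\<open>gaussian_transform_covariance_bound\<close>).

  \<^item> Positivity of \<open>R\<close>. With \<open>\<beta> = E (T Z * Z) / E (Z * Z)\<close> the residuals \<open>T (Z x) - \<beta> Z x\<close> are
  uncorrelated with the whole process \<open>Z\<close>, again by regression. So the quadratic form of \<open>R\<close> is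
  \<open>\<beta>\<^sup>2\<close> times that of the covariance matrix of \<open>Z\<close> plus a variance
  (\<open>uncorrelated_residual_domination\<close>), and \<open>\<beta> > 0\<close> because \<open>T\<close> is non-decreasing and not constant
  (\<open>gaussian_transform_slope\<close>). The form of \<open>Z\<close> is bounded below through its smallest eigenvalue
  (\<open>smallest_eigenvalue_le_quad_form\<close>).

  \<^item> From decay and positivity to the inverse. This is the Combes-Thomas argument: conjugating \<open>R\<close>
  with the diagonal matrix of the weights \<open>exp (\<eta> * infnorm (s i - s j))\<close>, \<open>j\<close> fixed, changes the
  quadratic form only a little for small \<open>\<eta>\<close>, uniformly in \<open>n\<close>, since exponential sums over
  well-separated points are bounded (\<open>separated_exp_sum_bounded\<close>). The conjugated inverse is therefore
  bounded, which says that \<open>R\<close> has an inverse with entries \<open>O (exp (- \<eta> * infnorm (s i - s j)))\<close>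
  (\<open>inverse_decay\<close>). Any power of the distance is dominated by the exponential.

  The independence of \<open>W\<close> and \<open>X\<close> comes from the factorisation of their joint characteristic function,
  by applying the uniqueness theorem on the line twice, each time to a reweighted measure
  (\<open>indep_var_if_char_factors\<close>).
\<close>

section \<open>Rayleigh quotients of real symmetric matrices\<close>

text \<open>
  All later arguments use plain sums over indices. This lemma and \<open>eigenvalueI\<close> are the bridge from
  such sums to matrices; a vector is a function of which only the values below \<open>n\<close> matter.
\<close>

lemma mat_inverse_if_kernel_trivial:
  fixes A :: "'a::field mat"
  assumes A: "A \<in> carrier_mat n n"
    and ker: "\<And>v. \<forall>i<n. (\<Sum>j<n. A $$ (i, j) * v j) = 0 \<Longrightarrow> \<forall>i<n. v i = 0"
  obtains B where "mat_inverse A = Some B"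
    and "\<And>i j. i < n \<Longrightarrow> j < n \<Longrightarrow> (\<Sum>k<n. A $$ (i, k) * B $$ (k, j)) = (if i = j then 1 else 0)"
    and "\<And>i j. i < n \<Longrightarrow> j < n \<Longrightarrow> (\<Sum>k<n. B $$ (i, k) * A $$ (k, j)) = (if i = j then 1 else 0)"
proof -
  have "Determinant.det A \<noteq> 0"
  proof
    assume "Determinant.det A = 0"
    then obtain v where v: "v \<in> carrier_vec n" "v \<noteq> 0\<^sub>v n" "A *\<^sub>v v = 0\<^sub>v n"
      using det_0_iff_vec_prod_zero_field[OF A] by blast
    have "\<forall>i<n. vec_index v i = 0"
    proof (rule ker, intro allI impI)
      fix i assume i: "i < n"
      have "(\<Sum>j<n. A $$ (i, j) * vec_index v j) = vec_index (A *\<^sub>v v) i"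
        using A v(1) i by (auto simp: scalar_prod_def atLeast0LessThan intro!: sum.cong)
      then show "(\<Sum>j<n. A $$ (i, j) * vec_index v j) = 0" using v(3) i by simp
    qed
    then have "v = 0\<^sub>v n" using v(1) by (intro eq_vecI) auto
    with v(2) show False ..
  qed
  then have "mat_inverse A \<noteq> None"
    using det_non_zero_imp_unit[OF A, where b = "()"] mat_inverse(1)[OF A, where b = "()"] by blast
  then obtain B where B: "mat_inverse A = Some B" by blast
  from mat_inverse(2)[OF A B] have AB: "A * B = 1\<^sub>m n" and BA: "B * A = 1\<^sub>m n"
    and Bc: "B \<in> carrier_mat n n" by auto
  have prod: "(P * Q) $$ (i, j) = (\<Sum>k<n. P $$ (i, k) * Q $$ (k, j))"
    if "P \<in> carrier_mat n n" "Q \<in> carrier_mat n n" "i < n" "j < n" for P Q :: "'a mat" and i j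
    using that by (auto simp: scalar_prod_def atLeast0LessThan intro!: sum.cong)
  show ?thesis
  proof (rule that[OF B])
    fix i j assume ij: "i < n" "j < n"
    show "(\<Sum>k<n. A $$ (i, k) * B $$ (k, j)) = (if i = j then 1 else 0)"
      using prod[OF A Bc ij] ij by (simp add: AB)
    show "(\<Sum>k<n. B $$ (i, k) * A $$ (k, j)) = (if i = j then 1 else 0)"
      using prod[OF Bc A ij] ij by (simp add: BA)
  qed
qed

lemma eigenvalueI:
  fixes A :: "'a::field mat"
  assumes A: "A \<in> carrier_mat n n"
    and ev: "\<And>i. i < n \<Longrightarrow> (\<Sum>j<n. A $$ (i, j) * v j) = e * v i"
    and nz: "i < n" "v i \<noteq> 0"
  shows "eigenvalue A e"
proof -
  let ?v = "Matrix.vec n v"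
  have "A *\<^sub>v ?v = e \<cdot>\<^sub>v ?v"
    using A ev by (intro eq_vecI) (auto simp: scalar_prod_def atLeast0LessThan)
  moreover have "?v \<noteq> 0\<^sub>v n" using nz by (metis index_vec index_zero_vec(1))
  ultimately show ?thesis
    using A unfolding eigenvalue_def eigenvector_def by (intro exI[of _ ?v]) auto
qed

definition quad_form :: "real mat \<Rightarrow> nat \<Rightarrow> (nat \<Rightarrow> real) \<Rightarrow> real" where
  "quad_form A n v = (\<Sum>i<n. \<Sum>j<n. v i * A $$ (i, j) * v j)"

lemma matvec_square_le:
  fixes G :: "nat \<Rightarrow> nat \<Rightarrow> real"
  shows "(\<Sum>i<n. (\<Sum>j<n. G i j * w j)\<^sup>2) \<le> (\<Sum>i<n. \<Sum>j<n. (G i j)\<^sup>2) * (\<Sum>j<n. (w j)\<^sup>2)"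
  unfolding sum_distrib_right by (rule sum_mono) (simp flip: sum_distrib_right add: Cauchy_Schwarz_ineq_sum)

text \<open>
  The eigenvalue is the infimum \<open>m\<close> of the form over the unit sphere. If \<open>m\<close> were not an
  eigenvalue, \<open>B = A - m I\<close> would be positive semidefinite and invertible. For such \<open>B\<close>, the
  Cauchy-Schwarz inequality of the form \<open>B\<close> gives \<open>\<bar>B v\<bar>\<^sup>2 \<le> L * (v, B v)\<close> for some constant \<open>L\<close>, while
  invertibility bounds \<open>\<bar>B v\<bar>\<close> from below on the sphere; so the form of \<open>B\<close> would be bounded away
  from 0 there, against the choice of \<open>m\<close>.
\<close>

lemma symmetric_has_bottom_eigenvalue:
  fixes A :: "real mat"
  assumes A: "A \<in> carrier_mat n n" and n: "n \<ge> 1"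
    and sym: "\<And>i j. i < n \<Longrightarrow> j < n \<Longrightarrow> A $$ (i, j) = A $$ (j, i)"
  obtains e where "eigenvalue A e" "\<And>v. e * (\<Sum>i<n. (v i)\<^sup>2) \<le> quad_form A n v"
proof -
  define N where "N v = (\<Sum>i<n. (v i)\<^sup>2)" for v :: "nat \<Rightarrow> real"
  define Q where "Q = {quad_form A n v |v. N v = 1}"
  have N0: "N v \<ge> 0" for v unfolding N_def by (simp add: sum_nonneg)
  have Nsc: "N (\<lambda>i. t * v i) = t\<^sup>2 * N v" for t v
    by (simp add: N_def power_mult_distrib sum_distrib_left)
  have qsc: "quad_form A n (\<lambda>i. t * v i) = t\<^sup>2 * quad_form A n v" for t v
    by (simp add: quad_form_def sum_distrib_left power2_eq_square algebra_simps)
  define L0 where "L0 = (\<Sum>i<n. \<Sum>j<n. \<bar>A $$ (i, j)\<bar>)"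
  have comp: "\<bar>v i\<bar> * \<bar>v j\<bar> \<le> N v" if "i < n" "j < n" for v i j
  proof -
    have "(v i)\<^sup>2 \<le> N v" "(v j)\<^sup>2 \<le> N v"
      unfolding N_def using that by (auto intro!: member_le_sum)
    then have "((v i)\<^sup>2 + (v j)\<^sup>2) / 2 \<le> (N v + N v) / 2"
      by (intro divide_right_mono add_mono) auto
    moreover have "\<bar>v i\<bar> * \<bar>v j\<bar> \<le> ((v i)\<^sup>2 + (v j)\<^sup>2) / 2"
      using sum_squares_bound[of "\<bar>v i\<bar>" "\<bar>v j\<bar>"] by simp
    ultimately show ?thesis by simp
  qed
  have qbd: "\<bar>quad_form A n v\<bar> \<le> L0 * N v" for v
  proof -
    have "\<bar>quad_form A n v\<bar> \<le> (\<Sum>i<n. \<Sum>j<n. \<bar>v i * A $$ (i, j) * v j\<bar>)"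
      unfolding quad_form_def
      by (rule order_trans[OF sum_abs sum_mono]) (rule sum_abs)
    also have "\<dots> \<le> (\<Sum>i<n. \<Sum>j<n. \<bar>A $$ (i, j)\<bar> * N v)"
    proof (intro sum_mono)
      fix i j assume "i \<in> {..<n}" "j \<in> {..<n}"
      then have "\<bar>A $$ (i, j)\<bar> * (\<bar>v i\<bar> * \<bar>v j\<bar>) \<le> \<bar>A $$ (i, j)\<bar> * N v"
        by (intro mult_left_mono comp) auto
      then show "\<bar>v i * A $$ (i, j) * v j\<bar> \<le> \<bar>A $$ (i, j)\<bar> * N v"
        by (simp add: abs_mult mult_ac)
    qed
    finally show ?thesis by (simp add: L0_def sum_distrib_right)
  qed
  have Qne: "Q \<noteq> {}"
  proof -
    have "N (\<lambda>i. if i = 0 then 1 else 0) = (\<Sum>i<n. if i = 0 then 1 else 0)"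
      unfolding N_def by (intro sum.cong) auto
    also have "\<dots> = 1" using n by simp
    finally show ?thesis unfolding Q_def by blast
  qed
  have Qbdd: "bdd_below Q"
  proof (rule bdd_belowI[of _ "- L0"])
    fix q assume "q \<in> Q"
    then obtain v where "q = quad_form A n v" "N v = 1" unfolding Q_def by blast
    then show "- L0 \<le> q" using qbd[of v] by simp
  qed
  define m where "m = Inf Q"
  have m_le: "m * N v \<le> quad_form A n v" for v
  proof (cases "N v = 0")
    case True
    then show ?thesis using qbd[of v] by simp
  next
    case False
    then have pos: "N v > 0" using N0[of v] by simp
    let ?t = "1 / sqrt (N v)"
    have t2: "?t\<^sup>2 = 1 / N v" using pos by (simp add: power_divide)
    have "N (\<lambda>i. ?t * v i) = 1" unfolding Nsc t2 using pos by simp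
    then have "m \<le> quad_form A n (\<lambda>i. ?t * v i)"
      unfolding m_def Q_def using Qbdd by (intro cInf_lower) (auto simp: Q_def)
    then have "m \<le> quad_form A n v / N v" unfolding qsc t2 by simp
    then show ?thesis using pos by (simp add: field_simps)
  qed
  have "eigenvalue A m"
  proof (rule ccontr)
    assume no: "\<not> eigenvalue A m"
    define B where "B = Matrix.mat n n (\<lambda>(i, j). A $$ (i, j) - (if i = j then m else 0))"
    have B: "B \<in> carrier_mat n n" by (simp add: B_def)
    have Bv: "(\<Sum>j<n. B $$ (i, j) * v j) = (\<Sum>j<n. A $$ (i, j) * v j) - m * v i"
      if "i < n" for i v
    proof -
      have "(\<Sum>j<n. B $$ (i, j) * v j)
          = (\<Sum>j<n. A $$ (i, j) * v j - (if i = j then m * v j else 0))"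
        using that by (intro sum.cong) (auto simp: B_def algebra_simps)
      then show ?thesis using that by (simp add: sum_subtractf)
    qed
    have "\<forall>i<n. v i = 0" if "\<forall>i<n. (\<Sum>j<n. B $$ (i, j) * v j) = 0" for v
    proof (rule ccontr)
      assume "\<not> (\<forall>i<n. v i = 0)"
      then obtain i where "i < n" "v i \<noteq> 0" by blast
      then have "eigenvalue A m"
        using that by (intro eigenvalueI[OF A, of v m i]) (simp_all add: Bv)
      with no show False ..
    qed
    from mat_inverse_if_kernel_trivial[OF B this] obtain G where
      G: "\<And>i j. i < n \<Longrightarrow> j < n \<Longrightarrow> (\<Sum>k<n. G $$ (i, k) * B $$ (k, j)) = (if i = j then 1 else 0)"
      by metis
    have qB: "quad_form B n v = quad_form A n v - m * N v" for v
    proof -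
      have "quad_form B n v = (\<Sum>i<n. v i * (\<Sum>j<n. B $$ (i, j) * v j))"
        by (simp add: quad_form_def sum_distrib_left mult.assoc)
      also have "\<dots> = (\<Sum>i<n. v i * ((\<Sum>j<n. A $$ (i, j) * v j) - m * v i))"
        by (intro sum.cong) (simp_all add: Bv)
      also have "\<dots> = quad_form A n v - m * N v"
        by (simp add: quad_form_def N_def right_diff_distrib sum_subtractf sum_distrib_left
            power2_eq_square mult_ac)
      finally show ?thesis .
    qed
    have B0: "0 \<le> quad_form B n v" for v using m_le[of v] qB[of v] by simp
    define L where "L = L0 + \<bar>m\<bar> + 1"
    have L0: "L > 0" by (auto simp: L_def L0_def sum_nonneg add_nonneg_pos)
    have BL: "quad_form B n w \<le> L * N w" for w
    proof -
      have "- (m * N w) \<le> \<bar>m\<bar> * N w" using N0[of w]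
        by (metis abs_ge_minus_self minus_mult_left mult_right_mono)
      then show ?thesis using qbd[of w] N0[of w] unfolding qB L_def
        by (simp add: algebra_simps)
    qed
    define g where "g = (\<Sum>i<n. \<Sum>j<n. (G $$ (i, j))\<^sup>2) + 1"
    have g0: "g > 0" by (auto simp: g_def intro!: add_nonneg_pos sum_nonneg)
    have gap: "1 / (g * L) \<le> quad_form B n v" if v1: "N v = 1" for v
    proof -
      define w where "w i = (\<Sum>j<n. B $$ (i, j) * v j)" for i
      have "v i = (\<Sum>k<n. G $$ (i, k) * w k)" if i: "i < n" for i
      proof -
        have "(\<Sum>k<n. G $$ (i, k) * w k) = (\<Sum>k<n. \<Sum>j<n. G $$ (i, k) * B $$ (k, j) * v j)"
          by (simp add: w_def sum_distrib_left mult.assoc)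
        also have "\<dots> = (\<Sum>j<n. (\<Sum>k<n. G $$ (i, k) * B $$ (k, j)) * v j)"
          by (subst sum.swap) (simp add: sum_distrib_right)
        also have "\<dots> = (\<Sum>j<n. (if i = j then v j else 0))"
          using i by (intro sum.cong) (simp_all add: G)
        finally show ?thesis using i by simp
      qed
      then have "N v = (\<Sum>i<n. (\<Sum>k<n. G $$ (i, k) * w k)\<^sup>2)"
        unfolding N_def by (intro sum.cong) simp_all
      also have "\<dots> \<le> (\<Sum>i<n. \<Sum>j<n. (G $$ (i, j))\<^sup>2) * N w"
        unfolding N_def by (rule matvec_square_le)
      also have "\<dots> \<le> g * N w" using N0[of w] by (simp add: g_def algebra_simps)
      finally have "1 / g \<le> N w" using v1 g0 by (simp add: field_simps)
      moreover have "N w \<le> L * quad_form B n v"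
      proof -
        define t where "t = 1 / L"
        have cross1: "(\<Sum>i<n. \<Sum>j<n. w i * B $$ (i, j) * v j) = N w"
          by (simp add: N_def w_def power2_eq_square sum_distrib_left mult.assoc)
        have cross2: "(\<Sum>i<n. \<Sum>j<n. v i * B $$ (i, j) * w j) = N w"
        proof -
          have "(\<Sum>i<n. \<Sum>j<n. v i * B $$ (i, j) * w j) = (\<Sum>j<n. \<Sum>i<n. v i * B $$ (i, j) * w j)"
            by (rule sum.swap)
          also have "\<dots> = (\<Sum>i<n. \<Sum>j<n. w i * B $$ (i, j) * v j)"
            by (intro sum.cong refl) (auto simp: B_def sym)
          finally show ?thesis using cross1 by simp
        qed
        \<comment> \<open>nonnegativity of the form at \<open>v - t w\<close>, where \<open>t = 1 / L\<close> makes the \<open>w\<close>-terms combine to \<open>- N w / L\<close>\<close>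
        have "quad_form B n (\<lambda>i. v i - t * w i) = quad_form B n v
            - t * (\<Sum>i<n. \<Sum>j<n. v i * B $$ (i, j) * w j)
            - t * (\<Sum>i<n. \<Sum>j<n. w i * B $$ (i, j) * v j) + t\<^sup>2 * quad_form B n w"
          unfolding quad_form_def sum_distrib_left sum_subtractf[symmetric] sum.distrib[symmetric]
          by (intro sum.cong refl) (simp add: algebra_simps power2_eq_square)
        then have "0 \<le> quad_form B n v - 2 * t * N w + t\<^sup>2 * quad_form B n w"
          using B0[of "\<lambda>i. v i - t * w i"] cross1 cross2 by simp
        also have "\<dots> \<le> quad_form B n v - 2 * t * N w + t\<^sup>2 * (L * N w)"
          using BL[of w] by (simp add: mult_left_mono)
        also have "\<dots> = quad_form B n v - N w / L"
          using L0 by (simp add: t_def power2_eq_square field_simps)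
        finally show ?thesis using L0 by (simp add: field_simps)
      qed
      ultimately have "1 / g \<le> L * quad_form B n v" by linarith
      then show ?thesis using L0 g0 by (simp add: field_simps)
    qed
    have "m + 1 / (g * L) \<le> Inf Q"
    proof (rule cInf_greatest[OF Qne])
      fix q assume "q \<in> Q"
      then obtain v where "q = quad_form A n v" "N v = 1" unfolding Q_def by blast
      then show "m + 1 / (g * L) \<le> q" using gap[of v] qB[of v] by simp
    qed
    then show False using L0 g0 unfolding m_def by (simp add: field_simps)
  qed
  with m_le show ?thesis using that unfolding N_def by blast
qed

lemma smallest_eigenvalue_le_quad_form:
  fixes A :: "real mat"
  assumes A: "A \<in> carrier_mat n n" and n: "n \<ge> 1"
    and sym: "\<And>i j. i < n \<Longrightarrow> j < n \<Longrightarrow> A $$ (i, j) = A $$ (j, i)"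
  shows "smallest_eigenvalue A * (\<Sum>i<n. (v i)\<^sup>2) \<le> quad_form A n v"
proof -
  from symmetric_has_bottom_eigenvalue[OF A n sym] obtain e where
    e: "eigenvalue A e" "e * (\<Sum>i<n. (v i)\<^sup>2) \<le> quad_form A n v" by metis
  have "smallest_eigenvalue A \<le> e"
    unfolding smallest_eigenvalue_def using e(1) card_finite_spectrum(1)[OF A]
    by (intro Min_le) (auto simp: spectrum_def)
  then have "smallest_eigenvalue A * (\<Sum>i<n. (v i)\<^sup>2) \<le> e * (\<Sum>i<n. (v i)\<^sup>2)"
    by (intro mult_right_mono sum_nonneg) auto
  with e(2) show ?thesis by linarith
qed

section \<open>Exponential sums over well-separated points\<close>

lemma well_separatedD:
  assumes "well_separated x"
  obtains r where "r > 0" "\<And>i j. i \<noteq> j \<Longrightarrow> r \<le> infnorm (x i - x j)"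
proof -
  define r where "r = (INF (i, j) \<in> {(i, j). i \<noteq> j}. infnorm (x i - x j))"
  have "r \<le> infnorm (x i - x j)" if "i \<noteq> j" for i j
  proof -
    have "bdd_below ((\<lambda>(i, j). infnorm (x i - x j)) ` {(i, j). i \<noteq> j})"
      by (rule bdd_belowI[of _ 0]) (auto simp: infnorm_pos_le)
    then show ?thesis unfolding r_def using cINF_lower[of "\<lambda>(i, j). infnorm (x i - x j)" _ "(i, j)"] that by auto
  qed
  moreover have "r > 0" using assms by (simp add: well_separated_def r_def)
  ultimately show ?thesis using that by blast
qed

lemma sum_power_nat_abs_le:
  fixes q :: real
  assumes q: "0 < q" "q < 1" and A: "finite A"
  shows "(\<Sum>m\<in>A. q ^ nat \<bar>m::int\<bar>) \<le> 2 / (1 - q)"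
proof -
  have geo: "(\<Sum>n\<in>S. q ^ n) \<le> 1 / (1 - q)" if "finite S" for S
  proof -
    have "(\<Sum>n\<in>S. q ^ n) \<le> (\<Sum>n. q ^ n)"
      using q that by (intro sum_le_suminf summable_geometric) auto
    then show ?thesis using q suminf_geometric[of q] by simp
  qed
  have part: "(\<Sum>m\<in>S. q ^ nat \<bar>m\<bar>) \<le> 1 / (1 - q)"
    if "finite S" "inj_on (\<lambda>m. nat \<bar>m\<bar>) S" for S :: "int set"
    using geo[of "(\<lambda>m. nat \<bar>m\<bar>) ` S"] that by (simp add: sum.reindex)
  have "A = {m\<in>A. m \<ge> 0} \<union> {m\<in>A. m < 0}" by auto
  then have "(\<Sum>m\<in>A. q ^ nat \<bar>m\<bar>)
      = (\<Sum>m\<in>{m\<in>A. m \<ge> 0}. q ^ nat \<bar>m\<bar>) + (\<Sum>m\<in>{m\<in>A. m < 0}. q ^ nat \<bar>m\<bar>)"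
    using A by (subst sum.union_disjoint[symmetric]) auto
  also have "\<dots> \<le> 1 / (1 - q) + 1 / (1 - q)"
    using A by (intro add_mono part) (auto simp: inj_on_def)
  finally show ?thesis by simp
qed

text \<open>
  Cubes of side \<open>r\<close> contain at most one point each, so the points are indexed injectively by integer
  vectors. Bounding the maximum norm below by the average of the coordinates turns
  the exponential into a product over coordinates, and the sum over integer vectors into
  a product of geometric series. The bound is independent of the centre \<open>x\<close> and of the set of points.
\<close>

lemma separated_exp_sum_bounded:
  fixes s :: "nat \<Rightarrow> 'a::euclidean_space"
  assumes r: "r > 0" and sep: "\<And>i j. i \<noteq> j \<Longrightarrow> r \<le> infnorm (s i - s j)" and c: "c > 0"
  shows "\<exists>S>0. \<forall>x F. finite F \<longrightarrow> (\<Sum>k\<in>F. exp (- c * infnorm (x - s k))) \<le> S"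
proof -
  define D where "D = real DIM('a)"
  have D: "D > 0" unfolding D_def by simp
  define a where "a = c * r / D"
  have a: "a > 0" using c r D by (simp add: a_def)
  define q where "q = exp (- a)"
  have q: "0 < q" "q < 1" using a by (auto simp: q_def)
  define G where "G = exp a * (2 / (1 - q))"
  have G: "G > 0" using q by (simp add: G_def)
  have "(\<Sum>k\<in>F. exp (- c * infnorm (x - s k))) \<le> G ^ DIM('a)" if F: "finite F" for x F
  proof -
    define m where "m k = restrict (\<lambda>b. \<lfloor>inner (x - s k) b / r\<rfloor>) Basis" for k
    define w where "w z = exp a * q ^ nat \<bar>z\<bar>" for z :: int
    have w0: "w z \<ge> 0" for z by (simp add: w_def q_def)
    define I where "I = (\<Union>k\<in>F. m k ` Basis)"
    have finI: "finite I" using F by (simp add: I_def)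
    have inj: "inj_on m F"
    proof (rule inj_onI, rule ccontr)
      fix k l assume eq: "m k = m l" and "k \<noteq> l"
      then have "r \<le> infnorm (s k - s l)" by (intro sep)
      also have "\<dots> < r"
        unfolding infnorm_Max
      proof (subst Max_less_iff, safe)
        fix b :: 'a assume b: "b \<in> Basis"
        have "\<lfloor>inner (x - s k) b / r\<rfloor> = \<lfloor>inner (x - s l) b / r\<rfloor>"
          using fun_cong[OF eq, of b] b by (simp add: m_def)
        then have "\<bar>inner (x - s k) b / r - inner (x - s l) b / r\<bar> < 1" by linarith
        also have "inner (x - s k) b / r - inner (x - s l) b / r = - inner (s k - s l) b / r"
          by (simp add: inner_diff_left diff_divide_distrib)
        finally show "\<bar>inner (s k - s l) b\<bar> < r" using r by (simp add: field_simps)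
      qed (auto simp: finite_imageI)
      finally show False by simp
    qed
    have "exp (- c * infnorm (x - s k)) \<le> (\<Prod>b\<in>Basis. w (m k b))" for k
    proof -
      define y where "y = x - s k"
      have "(\<Sum>b\<in>Basis. \<bar>inner y b\<bar>) \<le> (\<Sum>b\<in>(Basis::'a set). infnorm y)"
        by (intro sum_mono Basis_le_infnorm)
      then have "(\<Sum>b\<in>Basis. \<bar>inner y b\<bar>) \<le> D * infnorm y" by (simp add: D_def)
      then have "- c * infnorm y \<le> - (c / D) * (\<Sum>b\<in>Basis. \<bar>inner y b\<bar>)"
        using c D by (simp add: field_simps mult_left_mono)
      also have "\<dots> = (\<Sum>b\<in>Basis. - a * \<bar>inner y b / r\<bar>)"
        using r by (simp add: a_def sum_distrib_left sum_negf field_simps)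
      finally have "exp (- c * infnorm y) \<le> (\<Prod>b\<in>Basis. exp (- a * \<bar>inner y b / r\<bar>))"
        by (simp flip: exp_sum)
      also have "\<dots> \<le> (\<Prod>b\<in>Basis. w (m k b))"
      proof (rule prod_mono, safe)
        fix b :: 'a assume b: "b \<in> Basis"
        define z where "z = \<lfloor>inner y b / r\<rfloor>"
        \<comment> \<open>rounding down moves the coordinate by less than 1; this costs the factor \<open>exp a\<close> in \<open>w\<close>\<close>
        have "real_of_int \<bar>z\<bar> - 1 \<le> \<bar>inner y b / r\<bar>" unfolding z_def by linarith
        then have "- a * \<bar>inner y b / r\<bar> \<le> a + real (nat \<bar>z\<bar>) * (- a)"
          using a mult_left_mono[of "real_of_int \<bar>z\<bar> - 1" "\<bar>inner y b / r\<bar>" a]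
          by (simp add: algebra_simps)
        then have "exp (- a * \<bar>inner y b / r\<bar>) \<le> exp (a + real (nat \<bar>z\<bar>) * (- a))" by simp
        also have "\<dots> = w z" by (simp only: w_def q_def exp_add exp_of_nat_mult)
        also have "z = m k b" using b by (simp add: m_def z_def y_def)
        finally show "exp (- a * \<bar>inner y b / r\<bar>) \<le> w (m k b)" .
      qed simp
      finally show ?thesis by (simp add: y_def)
    qed
    then have "(\<Sum>k\<in>F. exp (- c * infnorm (x - s k))) \<le> (\<Sum>k\<in>F. \<Prod>b\<in>Basis. w (m k b))"
      by (intro sum_mono)
    also have "\<dots> = (\<Sum>p\<in>m ` F. \<Prod>b\<in>Basis. w (p b))"
      using inj by (simp add: sum.reindex)
    also have "\<dots> \<le> (\<Sum>p\<in>PiE (Basis::'a set) (\<lambda>_. I). \<Prod>b\<in>Basis. w (p b))"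
    proof (rule sum_mono2)
      show "m ` F \<subseteq> PiE Basis (\<lambda>_. I)" by (auto simp: I_def m_def)
    qed (use finI in \<open>auto intro!: finite_PiE prod_nonneg w0\<close>)
    also have "\<dots> = (\<Prod>b\<in>(Basis::'a set). \<Sum>z\<in>I. w z)"
      using finI by (subst prod_sum_PiE) auto
    also have "\<dots> \<le> (\<Prod>b\<in>(Basis::'a set). G)"
    proof (rule prod_mono, safe)
      have "(\<Sum>z\<in>I. w z) = exp a * (\<Sum>z\<in>I. q ^ nat \<bar>z\<bar>)"
        by (simp add: w_def sum_distrib_left)
      also have "\<dots> \<le> G"
        unfolding G_def by (intro mult_left_mono sum_power_nat_abs_le q finI) auto
      finally show "(\<Sum>z\<in>I. w z) \<le> G" .
    qed (simp add: sum_nonneg w0)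
    finally show ?thesis by simp
  qed
  then show ?thesis using G by (intro exI[of _ "G ^ DIM('a)"]) simp
qed

section \<open>Off-diagonal decay of inverse matrices\<close>

text \<open>
  Conjugating \<open>A\<close> with the diagonal matrix of the weights \<open>exp (f i)\<close> perturbs it by the entries
  \<open>A i k * (exp (f i - f k) - 1)\<close>. Their row sums are at most \<open>\<delta> / 2\<close> in absolute value, so by the
  Schur test the conjugated matrix still has a quadratic form of at least \<open>\<delta> / 2\<close>. Testing it on the
  weighted solution \<open>v i = exp (f i) * b i\<close> of \<open>A b = e\<^sub>j\<close> bounds \<open>v\<close> by \<open>2 / \<delta>\<close>.
\<close>

lemma Combes_Thomas_bound:
  fixes f b :: "nat \<Rightarrow> real" and A :: "real mat"
  assumes d: "\<delta> > 0"
    and form: "\<And>v. \<delta> * (\<Sum>i<n. (v i)\<^sup>2) \<le> quad_form A n v"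
    and pert: "\<And>i k. i < n \<Longrightarrow> k < n \<Longrightarrow> \<bar>A $$ (i, k)\<bar> * \<bar>exp (f i - f k) - 1\<bar> \<le> g i k"
    and gsym: "\<And>i k. g i k = g k i"
    and schur: "\<And>i. i < n \<Longrightarrow> (\<Sum>k<n. g i k) \<le> \<delta> / 2"
    and sol: "\<And>i. i < n \<Longrightarrow> (\<Sum>k<n. A $$ (i, k) * b k) = (if i = j then 1 else 0)"
    and j: "j < n" "f j = 0" and i: "i < n"
  shows "\<bar>b i\<bar> \<le> 2 / \<delta> * exp (- f i)"
proof -
  define v where "v i = exp (f i) * b i" for i
  define V where "V = (\<Sum>i<n. (v i)\<^sup>2)"
  have "v j = (\<Sum>i<n. if i = j then v i * exp (f i) else 0)"
    using j by simp
  also have "\<dots> = (\<Sum>i<n. v i * exp (f i) * (\<Sum>k<n. A $$ (i, k) * b k))"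
    by (intro sum.cong refl) (simp add: sol)
  also have "\<dots> = (\<Sum>i<n. \<Sum>k<n. v i * A $$ (i, k) * v k + v i * A $$ (i, k) * (exp (f i - f k) - 1) * v k)"
  proof -
    have "v i * exp (f i) * (A $$ (i, k) * b k)
        = v i * A $$ (i, k) * v k + v i * A $$ (i, k) * (exp (f i - f k) - 1) * v k" for i k
      by (simp add: v_def exp_diff field_simps)
    then show ?thesis by (simp add: sum_distrib_left)
  qed
  also have "\<dots> = quad_form A n v + (\<Sum>i<n. \<Sum>k<n. v i * A $$ (i, k) * (exp (f i - f k) - 1) * v k)"
    by (simp add: quad_form_def sum.distrib)
  finally have vj: "v j = quad_form A n v
    + (\<Sum>i<n. \<Sum>k<n. v i * A $$ (i, k) * (exp (f i - f k) - 1) * v k)" .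
  \<comment> \<open>Schur test for the symmetric majorant \<open>g\<close>, by \<open>2 * \<bar>v i * v k\<bar> \<le> (v i)\<^sup>2 + (v k)\<^sup>2\<close>\<close>
  have "- (\<Sum>i<n. \<Sum>k<n. v i * A $$ (i, k) * (exp (f i - f k) - 1) * v k)
      \<le> (\<Sum>i<n. \<Sum>k<n. ((v i)\<^sup>2 * g i k + (v k)\<^sup>2 * g i k) / 2)"
    unfolding sum_negf[symmetric]
  proof (intro sum_mono)
    fix i k assume "i \<in> {..<n}" "k \<in> {..<n}"
    then have p: "\<bar>A $$ (i, k)\<bar> * \<bar>exp (f i - f k) - 1\<bar> \<le> g i k" using pert by simp
    then have g0: "0 \<le> g i k" using mult_nonneg_nonneg[OF abs_ge_zero abs_ge_zero] order_trans by blast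
    have "- (v i * A $$ (i, k) * (exp (f i - f k) - 1) * v k)
        \<le> (\<bar>A $$ (i, k)\<bar> * \<bar>exp (f i - f k) - 1\<bar>) * (\<bar>v i\<bar> * \<bar>v k\<bar>)"
      by (rule order_trans[OF abs_ge_minus_self]) (simp add: abs_mult mult_ac)
    also have "\<dots> \<le> g i k * (((v i)\<^sup>2 + (v k)\<^sup>2) / 2)"
      using p g0 sum_squares_bound[of "\<bar>v i\<bar>" "\<bar>v k\<bar>"] by (intro mult_mono) auto
    finally show "- (v i * A $$ (i, k) * (exp (f i - f k) - 1) * v k)
        \<le> ((v i)\<^sup>2 * g i k + (v k)\<^sup>2 * g i k) / 2"
      by (simp add: field_simps)
  qed
  also have "\<dots> = (\<Sum>i<n. (v i)\<^sup>2 * (\<Sum>k<n. g i k))"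
  proof -
    have "(\<Sum>i<n. \<Sum>k<n. (v k)\<^sup>2 * g i k) = (\<Sum>i<n. \<Sum>k<n. (v i)\<^sup>2 * g i k)"
      by (subst sum.swap) (intro sum.cong refl arg_cong2[where f = "(*)"] gsym)
    then show ?thesis
      by (simp add: sum.distrib add_divide_distrib sum_distrib_left flip: sum_divide_distrib)
  qed
  also have "\<dots> \<le> (\<Sum>i<n. (v i)\<^sup>2 * (\<delta> / 2))"
    by (intro sum_mono mult_left_mono schur) auto
  also have "\<dots> = \<delta> / 2 * V" by (simp add: V_def sum_distrib_left mult.commute)
  finally have key: "\<delta> / 2 * V \<le> v j"
    using vj form[of v] unfolding V_def by (simp add: field_simps)
  have le_V: "(v i)\<^sup>2 \<le> V" if "i < n" for i
    unfolding V_def using that by (auto intro!: member_le_sum)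
  have V0: "V \<ge> 0" unfolding V_def by (simp add: sum_nonneg)
  have vj0: "0 \<le> v j" using key V0 d by (smt (verit) mult_nonneg_nonneg divide_nonneg_nonneg)
  have "\<delta> / 2 * (v j)\<^sup>2 \<le> v j" using key le_V[OF j(1)] d
    by (smt (verit) mult_left_mono divide_nonneg_nonneg)
  then have vj2: "v j \<le> 2 / \<delta>"
    using d vj0 by (cases "v j = 0") (auto simp: power2_eq_square field_simps)
  have "V \<le> 2 / \<delta> * v j" using key d by (simp add: field_simps)
  also have "\<dots> \<le> 2 / \<delta> * (2 / \<delta>)" using vj2 d by (intro mult_left_mono) auto
  finally have "(v i)\<^sup>2 \<le> (2 / \<delta>)\<^sup>2" using le_V[OF i] by (simp add: power2_eq_square)
  then have "\<bar>v i\<bar> \<le> 2 / \<delta>" using d by (simp add: abs_le_square_iff flip: abs_le_square_iff)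
  then have "exp (f i) * \<bar>b i\<bar> \<le> 2 / \<delta>" by (simp add: v_def abs_mult)
  then have "exp (- f i) * (exp (f i) * \<bar>b i\<bar>) \<le> exp (- f i) * (2 / \<delta>)"
    by (intro mult_left_mono) auto
  moreover have "exp (- f i) * (exp (f i) * \<bar>b i\<bar>) = \<bar>b i\<bar>"
    by (simp add: exp_minus flip: mult.assoc)
  ultimately show ?thesis by (simp only: mult.commute)
qed

lemma abs_exp_minus_one_le: "\<bar>exp x - 1\<bar> \<le> \<bar>x\<bar> * exp \<bar>x\<bar>" for x :: real
proof (cases "x \<ge> 0")
  case True
  have "1 - x \<le> exp (- x)" using exp_ge_add_one_self[of "- x"] by simp
  then have "exp x * (1 - x) \<le> exp x * exp (- x)" by (intro mult_left_mono) auto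
  then show ?thesis using True by (simp add: algebra_simps flip: exp_add)
next
  case False
  have "1 - exp x \<le> \<bar>x\<bar> * 1" using False exp_ge_add_one_self[of x] by linarith
  also have "\<dots> \<le> \<bar>x\<bar> * exp \<bar>x\<bar>" by (intro mult_left_mono) auto
  finally show ?thesis using False by simp
qed

text \<open>
  The weight in \<open>Combes_Thomas_bound\<close> is \<open>f i = \<eta> * infnorm (s i - s j)\<close>, for the column \<open>j\<close> of the inverse.
  The triangle inequality gives \<open>\<bar>f i - f l\<bar> \<le> \<eta> * t\<close> with \<open>t = infnorm (s i - s l)\<close>, so the perturbation is
  at most \<open>C * exp (- c * t) * \<eta> * t * exp (\<eta> * t)\<close>: half of the decay rate absorbs \<open>t\<close> and
  \<open>exp (\<eta> * t)\<close>, the other half makes the row sums finite, and the factor \<open>\<eta>\<close> makes them small.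
\<close>

lemma inverse_decay:
  fixes s :: "nat \<Rightarrow> 'a::euclidean_space" and k :: "'a \<Rightarrow> real"
  assumes r: "r > 0" and sep: "\<And>i j. i \<noteq> j \<Longrightarrow> r \<le> infnorm (s i - s j)"
    and c: "c > 0" and decay: "\<And>x. \<bar>k x\<bar> \<le> C * exp (- c * infnorm x)"
    and d: "\<delta> > 0"
    and form: "\<And>n v. \<delta> * (\<Sum>i<n. (v i)\<^sup>2) \<le> (\<Sum>i<n. \<Sum>j<n. v i * k (s i - s j) * v j)"
  obtains \<eta> where "\<eta> > 0" "\<And>n. \<exists>B. mat_inverse (Matrix.mat n n (\<lambda>(i, j). k (s i - s j))) = Some B
     \<and> (\<forall>i<n. \<forall>j<n. \<bar>B $$ (i, j)\<bar> \<le> 2 / \<delta> * exp (- \<eta> * infnorm (s i - s j)))"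
proof -
  have "c / 2 > 0" using c by simp
  then have "\<exists>S>0. \<forall>x F. finite F \<longrightarrow> (\<Sum>k\<in>F. exp (- (c / 2) * infnorm (x - s k))) \<le> S"
    by (intro separated_exp_sum_bounded[where s = s and r = r] r sep)
  then obtain S where
    S: "S > 0" "\<forall>x F. finite F \<longrightarrow> (\<Sum>k\<in>F. exp (- (c / 2) * infnorm (x - s k))) \<le> S"
    by (elim exE conjE)
  have C: "C \<ge> 0" using order_trans[OF abs_ge_zero decay[of 0]] by (simp add: infnorm_0)
  \<comment> \<open>\<open>c / 4\<close> keeps half of the decay rate; the second bound makes the row sums of \<open>g\<close>
    at most \<open>\<delta> / 2\<close>, and its summand 1 avoids division by 0\<close>
  define \<eta> where "\<eta> = min (c / 4) (\<delta> * c / (8 * (C * S + 1)))"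
  have CS: "C * S + 1 > 0" using C S by (simp add: add_nonneg_pos)
  have eta: "\<eta> > 0" using c d CS by (simp add: \<eta>_def)
  have eta1: "\<eta> \<le> c / 4" unfolding \<eta>_def by (rule min.cobounded1)
  have eta2: "4 * C * \<eta> / c * S \<le> \<delta> / 2"
  proof -
    have "\<eta> \<le> \<delta> * c / (8 * (C * S + 1))" by (simp add: \<eta>_def)
    then have "\<eta> * (8 * (C * S + 1)) \<le> \<delta> * c" using CS by (simp add: field_simps)
    then have "8 * (C * S * \<eta>) \<le> \<delta> * c" using eta by (simp add: algebra_simps)
    then show ?thesis using c by (simp add: field_simps)
  qed
  show ?thesis
  proof (rule that[OF eta])
    fix n
    define A where "A = Matrix.mat n n (\<lambda>(i, j). k (s i - s j))"
    have A: "A \<in> carrier_mat n n" by (simp add: A_def)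
    have Aij: "A $$ (i, j) = k (s i - s j)" if "i < n" "j < n" for i j
      using that by (simp add: A_def)
    have qf: "\<delta> * (\<Sum>i<n. (v i)\<^sup>2) \<le> quad_form A n v" for v
      using form[where v=v and n=n] by (simp add: quad_form_def Aij)
    have ker: "\<forall>i<n. v i = 0" if "\<forall>i<n. (\<Sum>j<n. A $$ (i, j) * v j) = 0" for v
    proof -
      have "quad_form A n v = (\<Sum>i<n. v i * (\<Sum>j<n. A $$ (i, j) * v j))"
        by (simp add: quad_form_def sum_distrib_left mult.assoc)
      also have "\<dots> = 0" using that by simp
      finally have "(\<Sum>i<n. (v i)\<^sup>2) \<le> 0" using qf[of v] d by (simp add: mult_le_0_iff)
      then have "(\<Sum>i<n. (v i)\<^sup>2) = 0" by (simp add: sum_nonneg antisym)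
      then show ?thesis by (simp add: sum_nonneg_eq_0_iff)
    qed
    from mat_inverse_if_kernel_trivial[OF A ker] obtain B where B: "mat_inverse A = Some B"
      and AB: "\<And>i j. i < n \<Longrightarrow> j < n \<Longrightarrow> (\<Sum>k<n. A $$ (i, k) * B $$ (k, j)) = (if i = j then 1 else 0)"
      by metis
    have "\<bar>B $$ (i, j)\<bar> \<le> 2 / \<delta> * exp (- \<eta> * infnorm (s i - s j))" if i: "i < n" and j: "j < n" for i j
    proof -
      define f where "f i = \<eta> * infnorm (s i - s j)" for i
      define g where "g i l = 4 * C * \<eta> / c * exp (- (c / 2) * infnorm (s i - s l))" for i l
      have "\<bar>B $$ (i, j)\<bar> \<le> 2 / \<delta> * exp (- f i)"
      proof (rule Combes_Thomas_bound[where A=A and n=n and g=g and j=j and b="\<lambda>i. B $$ (i, j)"])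
        fix i l assume il: "i < n" "l < n"
        define t where "t = infnorm (s i - s l)"
        have t: "t \<ge> 0" by (simp add: t_def infnorm_pos_le)
        have "\<bar>infnorm (s i - s j) - infnorm (s l - s j)\<bar> \<le> t"
          using absdiff_infnorm[of "s i - s j" "s l - s j"] by (simp add: t_def)
        then have ft: "\<bar>f i - f l\<bar> \<le> \<eta> * t"
          using eta by (simp add: f_def abs_mult flip: right_diff_distrib)
        have "\<bar>exp (f i - f l) - 1\<bar> \<le> \<bar>f i - f l\<bar> * exp \<bar>f i - f l\<bar>"
          by (rule abs_exp_minus_one_le)
        also have "\<dots> \<le> (\<eta> * t) * exp (c / 4 * t)"
        proof (intro mult_mono)
          show "exp \<bar>f i - f l\<bar> \<le> exp (c / 4 * t)"
            using ft mult_right_mono[OF eta1 t] by simp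
        qed (use ft eta t in auto)
        also have "\<dots> \<le> (\<eta> * (4 / c * exp (c / 4 * t))) * exp (c / 4 * t)"
        proof (intro mult_right_mono mult_left_mono)
          have "c / 4 * t \<le> exp (c / 4 * t)" using exp_ge_add_one_self[of "c / 4 * t"] by linarith
          then show "t \<le> 4 / c * exp (c / 4 * t)" using c by (simp add: field_simps)
        qed (use eta in auto)
        also have "\<dots> = 4 * \<eta> / c * (exp (c / 4 * t) * exp (c / 4 * t))" by simp
        also have "exp (c / 4 * t) * exp (c / 4 * t) = exp (c / 2 * t)"
          by (simp flip: exp_add)
        finally have *: "\<bar>exp (f i - f l) - 1\<bar> \<le> 4 * \<eta> / c * exp (c / 2 * t)" .
        have "\<bar>A $$ (i, l)\<bar> * \<bar>exp (f i - f l) - 1\<bar>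
            \<le> (C * exp (- c * t)) * (4 * \<eta> / c * exp (c / 2 * t))"
          using * decay[of "s i - s l"] C by (intro mult_mono) (auto simp: Aij il t_def)
        also have "\<dots> = 4 * C * \<eta> / c * (exp (- c * t) * exp (c / 2 * t))" by simp
        also have "\<dots> = g i l" by (simp add: g_def t_def flip: exp_add)
        finally show "\<bar>A $$ (i, l)\<bar> * \<bar>exp (f i - f l) - 1\<bar> \<le> g i l" .
      next
        fix i assume "i < n"
        have "(\<Sum>l<n. g i l) = 4 * C * \<eta> / c * (\<Sum>l<n. exp (- (c / 2) * infnorm (s i - s l)))"
          by (simp add: g_def sum_distrib_left)
        also have "\<dots> \<le> 4 * C * \<eta> / c * S"
          using S(2) C eta c by (intro mult_left_mono) auto
        finally show "(\<Sum>l<n. g i l) \<le> \<delta> / 2" using eta2 by linarith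
      next
        show "g i l = g l i" for i l by (simp add: g_def infnorm_sub)
      qed (use d qf AB i j in \<open>auto simp: f_def infnorm_0\<close>)
      then show ?thesis by (simp add: f_def)
    qed
    with B show "\<exists>B. mat_inverse (Matrix.mat n n (\<lambda>(i, j). k (s i - s j))) = Some B
     \<and> (\<forall>i<n. \<forall>j<n. \<bar>B $$ (i, j)\<bar> \<le> 2 / \<delta> * exp (- \<eta> * infnorm (s i - s j)))"
      unfolding A_def by blast
  qed
qed

text \<open>
  This is \<open>ln u \<le> u - 1\<close> at \<open>u = \<eta> * t / p\<close>.
\<close>

lemma powr_le_exp:
  fixes p \<eta> t :: real
  assumes "p > 0" "\<eta> > 0" "t \<ge> 0"
  shows "t powr p \<le> (p / \<eta>) powr p * exp (\<eta> * t)"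
proof (cases "t = 0")
  case False
  define u where "u = \<eta> * t / p"
  have u: "u > 0" using assms False by (simp add: u_def)
  have "t powr p = (p / \<eta>) powr p * u powr p"
    using assms u by (simp add: u_def flip: powr_mult)
  also have "u powr p \<le> exp (\<eta> * t)"
  proof -
    have "p * ln u \<le> p * u"
      using ln_le_minus_one[OF u] assms by (intro mult_left_mono) auto
    also have "\<dots> = \<eta> * t" using assms by (simp add: u_def)
    finally show ?thesis using u by (simp add: powr_def)
  qed
  finally show ?thesis by (simp add: mult_left_mono)
qed simp

lemma exp_le_inverse_polynomial:
  fixes p \<eta> t :: real
  assumes "p > 0" "\<eta> > 0" "t \<ge> 0"
  shows "exp (- \<eta> * t) \<le> (1 + (p / \<eta>) powr p) / (1 + t powr p)"
proof -
  have "1 + t powr p \<le> (1 + (p / \<eta>) powr p) * exp (\<eta> * t)"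
    using powr_le_exp[OF assms] assms one_le_exp_iff[of "\<eta> * t"] by (simp add: algebra_simps add_mono)
  then show ?thesis by (simp add: exp_minus field_simps add_pos_nonneg)
qed

section \<open>Independence from characteristic functions\<close>

text \<open>
  After normalisation \<open>g\<close> is a probability density with respect to \<open>M\<close>. The assumption says that \<open>X\<close> has
  the same characteristic function under this new measure as under \<open>M\<close>, hence the same law.
\<close>

lemma (in prob_space) weight_factors_if_char_factors:
  fixes X g :: "'a \<Rightarrow> real"
  assumes X[measurable]: "X \<in> borel_measurable M" and g[measurable]: "g \<in> borel_measurable M"
    and g0: "\<And>\<omega>. 0 \<le> g \<omega>" and gK: "\<And>\<omega>. g \<omega> \<le> K"
    and char: "\<And>t. (\<integral>\<omega>. g \<omega> *\<^sub>R iexp (t * X \<omega>) \<partial>M) = expectation g *\<^sub>R (\<integral>\<omega>. iexp (t * X \<omega>) \<partial>M)"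
    and B[measurable]: "B \<in> sets borel"
  shows "expectation (\<lambda>\<omega>. g \<omega> * indicator B (X \<omega>))
    = expectation g * expectation (\<lambda>\<omega>. indicator B (X \<omega>))"
proof -
  have gi: "integrable M g"
    by (rule integrable_const_bound[of _ K]) (use g0 gK in auto)
  define e where "e = expectation g"
  have "e \<ge> 0" unfolding e_def using g0 by simp
  show ?thesis
  proof (cases "e = 0")
    case True
    then have "AE \<omega> in M. g \<omega> = 0"
      using integral_nonneg_eq_0_iff_AE[OF gi] g0 by (simp add: e_def)
    then have "expectation (\<lambda>\<omega>. g \<omega> * indicator B (X \<omega>)) = expectation (\<lambda>\<omega>. 0)"
      by (intro integral_cong_AE) auto
    then show ?thesis using True by (simp add: e_def)
  next
    case False
    with \<open>e \<ge> 0\<close> have e: "e > 0" by simp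
    define N where "N = density M (\<lambda>\<omega>. ennreal (g \<omega> / e))"
    have sN[measurable_cong]: "sets N = sets M" by (simp add: N_def)
    have "emeasure N (space N) = (\<integral>\<^sup>+ \<omega>. ennreal (g \<omega> / e) \<partial>M)"
      by (simp add: N_def emeasure_density cong: nn_integral_cong)
    also have "\<dots> = ennreal (\<integral>\<omega>. g \<omega> / e \<partial>M)"
      using gi g0 e by (intro nn_integral_eq_integral) auto
    also have "\<dots> = 1" using e by (simp add: e_def)
    finally interpret N: prob_space N by (rule prob_spaceI)
    have XN: "X \<in> borel_measurable N" by measurable
    have intN: "(\<integral>\<omega>. f \<omega> \<partial>N) = (1 / e) *\<^sub>R (\<integral>\<omega>. g \<omega> *\<^sub>R f \<omega> \<partial>M)"
      if "f \<in> borel_measurable M" for f :: "'a \<Rightarrow> 'b::{banach, second_countable_topology}"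
    proof -
      have "(\<integral>\<omega>. f \<omega> \<partial>N) = (\<integral>\<omega>. (g \<omega> / e) *\<^sub>R f \<omega> \<partial>M)"
        unfolding N_def using that g0 e by (intro integral_density) auto
      also have "\<dots> = (\<integral>\<omega>. (1 / e) *\<^sub>R (g \<omega> *\<^sub>R f \<omega>) \<partial>M)" by simp
      finally show ?thesis by (simp only: integral_scaleR_right)
    qed
    have "char (distr N borel X) t = char (distr M borel X) t" for t
    proof -
      have "char (distr N borel X) t = (\<integral>\<omega>. iexp (t * X \<omega>) \<partial>N)"
        unfolding char_def using XN by (subst integral_distr) auto
      also have "\<dots> = (1 / e) *\<^sub>R (\<integral>\<omega>. g \<omega> *\<^sub>R iexp (t * X \<omega>) \<partial>M)"
        by (rule intN) measurable
      also have "\<dots> = (1 / e) *\<^sub>R (e *\<^sub>R (\<integral>\<omega>. iexp (t * X \<omega>) \<partial>M))"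
        by (simp only: char e_def)
      also have "\<dots> = char (distr M borel X) t"
        unfolding char_def using e by (subst integral_distr) auto
      finally show ?thesis .
    qed
    then have eq: "distr N borel X = distr M borel X"
      by (intro Levy_uniqueness N.real_distribution_distr real_distribution_distr XN X) auto
    have "(\<integral>\<omega>. indicator B (X \<omega>) \<partial>N) = (\<integral>x. indicator B x \<partial>distr N borel X :: real)"
      using XN by (subst integral_distr) auto
    also have "\<dots> = expectation (\<lambda>\<omega>. indicator B (X \<omega>))"
      unfolding eq by (subst integral_distr) auto
    finally have "(1 / e) * expectation (\<lambda>\<omega>. g \<omega> * indicator B (X \<omega>))
        = expectation (\<lambda>\<omega>. indicator B (X \<omega>))"
      by (subst (asm) intN) auto
    then show ?thesis using e by (simp add: e_def field_simps)
  qed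
qed

text \<open>
  The uniqueness theorem on the line suffices if the two variables are treated one after the
  other. First the nonnegative weights \<open>1 + cos (b * W + c)\<close>, whose
  mixed characteristic functions with \<open>X\<close> are known by assumption, show that
  \<open>cos (b * W + c)\<close> and the events of \<open>X\<close> factor. Adding up the phases \<open>c = 0\<close> and
  \<open>c = - pi / 2\<close> gives \<open>exp (i b W)\<close>; thus the indicator of an event of \<open>X\<close> is itself a weight to
  which \<open>weight_factors_if_char_factors\<close> applies, now with \<open>W\<close> as the variable.
\<close>

lemma (in prob_space) indep_var_if_char_factors:
  fixes X W :: "'a \<Rightarrow> real"
  assumes X[measurable]: "X \<in> borel_measurable M" and W[measurable]: "W \<in> borel_measurable M"
    and char: "\<And>a b. (\<integral>\<omega>. iexp (a * X \<omega> + b * W \<omega>) \<partial>M)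
      = (\<integral>\<omega>. iexp (a * X \<omega>) \<partial>M) * (\<integral>\<omega>. iexp (b * W \<omega>) \<partial>M)"
  shows "indep_var borel X borel W"
proof -
  have ii[simp]: "integrable M (\<lambda>\<omega>. iexp (f \<omega>))" if [measurable]: "f \<in> borel_measurable M" for f :: "'a \<Rightarrow> real"
    by (rule integrable_const_bound[of _ 1]) auto
  have cos_iexp: "complex_of_real (cos (b * w + c)) = (iexp c * iexp (b * w) + iexp (- c) * iexp (- b * w)) / 2"
    for b c w :: real
    by (simp add: cos_exp_eq algebra_simps flip: exp_add cos_of_real)
  have i1: "integrable M (\<lambda>\<omega>. iexp c * iexp (b * W \<omega>))" for b c
    by (intro integrable_mult_right ii) measurable
  have i2: "integrable M (\<lambda>\<omega>. iexp c * iexp (a * X \<omega> + b * W \<omega>))" for a b c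
    by (intro integrable_mult_right ii) measurable
  have iexp_add: "iexp (x + y) = iexp y * iexp x" for x y
    by (simp add: distrib_left exp_add mult.commute)
  define \<phi> where "\<phi> b = (\<integral>\<omega>. iexp (b * W \<omega>) \<partial>M)" for b
  define \<psi> where "\<psi> a = (\<integral>\<omega>. iexp (a * X \<omega>) \<partial>M)" for a
  have cosW: "complex_of_real (expectation (\<lambda>\<omega>. cos (b * W \<omega> + c))) = (iexp c * \<phi> b + iexp (- c) * \<phi> (- b)) / 2" for b c
  proof -
    have "complex_of_real (expectation (\<lambda>\<omega>. cos (b * W \<omega> + c)))
        = (\<integral>\<omega>. (iexp c * iexp (b * W \<omega>) + iexp (- c) * iexp (- b * W \<omega>)) / 2 \<partial>M)"
      by (simp only: integral_complex_of_real[symmetric] cos_iexp)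
    also have "\<dots> = (iexp c * \<phi> b + iexp (- c) * \<phi> (- b)) / 2"
      unfolding \<phi>_def
      by (simp only: integral_divide_zero Bochner_Integration.integral_add[OF i1 i1] integral_mult_right_zero)
    finally show ?thesis .
  qed
  have cosXW: "(\<integral>\<omega>. cos (b * W \<omega> + c) *\<^sub>R iexp (a * X \<omega>) \<partial>M)
      = expectation (\<lambda>\<omega>. cos (b * W \<omega> + c)) *\<^sub>R \<psi> a" for a b c
  proof -
    have "(\<integral>\<omega>. cos (b * W \<omega> + c) *\<^sub>R iexp (a * X \<omega>) \<partial>M)
        = (\<integral>\<omega>. (iexp c * iexp (a * X \<omega> + b * W \<omega>) + iexp (- c) * iexp (a * X \<omega> + (- b) * W \<omega>)) / 2 \<partial>M)"
      unfolding scaleR_conv_of_real cos_iexp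
      by (intro Bochner_Integration.integral_cong refl)
        (simp only: iexp_add distrib_right mult.assoc times_divide_eq_left)
    also have "\<dots> = (iexp c * (\<integral>\<omega>. iexp (a * X \<omega> + b * W \<omega>) \<partial>M)
        + iexp (- c) * (\<integral>\<omega>. iexp (a * X \<omega> + (- b) * W \<omega>) \<partial>M)) / 2"
      by (simp only: integral_divide_zero Bochner_Integration.integral_add[OF i2 i2] integral_mult_right_zero)
    also have "\<dots> = complex_of_real (expectation (\<lambda>\<omega>. cos (b * W \<omega> + c))) * \<psi> a"
      unfolding char cosW \<psi>_def \<phi>_def by (simp add: field_simps)
    finally show ?thesis by (simp only: scaleR_conv_of_real)
  qed
  have ci: "integrable M (\<lambda>\<omega>. cos (b * W \<omega> + c))" for b c
    by (rule integrable_const_bound[of _ 1]) auto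
  have stage1: "expectation (\<lambda>\<omega>. cos (b * W \<omega> + c) * indicator A (X \<omega>))
      = expectation (\<lambda>\<omega>. cos (b * W \<omega> + c)) * expectation (\<lambda>\<omega>. indicator A (X \<omega>))"
    if [measurable]: "A \<in> sets borel" for A b c
  proof -
    have iA: "integrable M (\<lambda>\<omega>. indicator A (X \<omega>) :: real)"
      by (rule integrable_const_bound[of _ 1]) (auto simp: indicator_def)
    have icA: "integrable M (\<lambda>\<omega>. cos (b * W \<omega> + c) * indicator A (X \<omega>))"
      by (rule integrable_const_bound[of _ 1]) (auto simp: indicator_def)
    have "expectation (\<lambda>\<omega>. (1 + cos (b * W \<omega> + c)) * indicator A (X \<omega>))
        = expectation (\<lambda>\<omega>. 1 + cos (b * W \<omega> + c)) * expectation (\<lambda>\<omega>. indicator A (X \<omega>))"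
    proof (rule weight_factors_if_char_factors[where K = 2])
      fix t
      have "(\<integral>\<omega>. (1 + cos (b * W \<omega> + c)) *\<^sub>R iexp (t * X \<omega>) \<partial>M)
          = (\<integral>\<omega>. iexp (t * X \<omega>) \<partial>M) + (\<integral>\<omega>. cos (b * W \<omega> + c) *\<^sub>R iexp (t * X \<omega>) \<partial>M)"
        unfolding scaleR_add_left scaleR_one
      proof (rule Bochner_Integration.integral_add)
        show "integrable M (\<lambda>\<omega>. cos (b * W \<omega> + c) *\<^sub>R iexp (t * X \<omega>))"
          by (rule integrable_const_bound[of _ 1]) auto
        show "integrable M (\<lambda>\<omega>. iexp (t * X \<omega>))"
          by (rule ii) measurable
      qed
      also have "\<dots> = expectation (\<lambda>\<omega>. 1 + cos (b * W \<omega> + c)) *\<^sub>R (\<integral>\<omega>. iexp (t * X \<omega>) \<partial>M)"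
        using ci by (simp only: cosXW \<psi>_def[symmetric]) (simp add: prob_space scaleR_add_left)
      finally show "(\<integral>\<omega>. (1 + cos (b * W \<omega> + c)) *\<^sub>R iexp (t * X \<omega>) \<partial>M)
          = expectation (\<lambda>\<omega>. 1 + cos (b * W \<omega> + c)) *\<^sub>R (\<integral>\<omega>. iexp (t * X \<omega>) \<partial>M)" .
    next
      show "0 \<le> 1 + cos (b * W \<omega> + c)" for \<omega>
        using cos_ge_minus_one[of "b * W \<omega> + c"] by linarith
    qed auto
    then show ?thesis using iA icA ci by (simp add: distrib_right prob_space)
  qed
  have stage2: "expectation (\<lambda>\<omega>. indicator A (X \<omega>) * indicator B (W \<omega>))
      = expectation (\<lambda>\<omega>. indicator A (X \<omega>)) * (expectation (\<lambda>\<omega>. indicator B (W \<omega>)) :: real)"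
    if A[measurable]: "A \<in> sets borel" and B[measurable]: "B \<in> sets borel" for A B
  proof (rule weight_factors_if_char_factors[where K = 1])
    fix t
    have ieq: "iexp x = complex_of_real (cos (x + 0)) + \<i> * complex_of_real (cos (x + - (pi / 2)))" for x
      by (simp add: cis_conv_exp[symmetric] complex_eq_iff cos_diff)
    have icA: "integrable M (\<lambda>\<omega>. cos (t * W \<omega> + c) * indicator A (X \<omega>))" for c
      by (rule integrable_const_bound[of _ 1]) (auto simp: indicator_def)
    have "(\<integral>\<omega>. indicator A (X \<omega>) *\<^sub>R iexp (t * W \<omega>) \<partial>M)
        = (\<integral>\<omega>. complex_of_real (cos (t * W \<omega> + 0) * indicator A (X \<omega>))
          + \<i> * complex_of_real (cos (t * W \<omega> + - (pi / 2)) * indicator A (X \<omega>)) \<partial>M)"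
      unfolding ieq by (intro Bochner_Integration.integral_cong refl)
        (simp add: scaleR_conv_of_real algebra_simps)
    also have "\<dots> = complex_of_real (expectation (\<lambda>\<omega>. cos (t * W \<omega> + 0) * indicator A (X \<omega>)))
       + \<i> * complex_of_real (expectation (\<lambda>\<omega>. cos (t * W \<omega> + - (pi / 2)) * indicator A (X \<omega>)))"
      using icA[of 0] icA[of "- (pi / 2)"]
      by (subst Bochner_Integration.integral_add) (auto simp del: of_real_mult add_0_right)
    also have "\<dots> = expectation (\<lambda>\<omega>. indicator A (X \<omega>)) *\<^sub>R
       (complex_of_real (expectation (\<lambda>\<omega>. cos (t * W \<omega> + 0)))
       + \<i> * complex_of_real (expectation (\<lambda>\<omega>. cos (t * W \<omega> + - (pi / 2)))))"
      unfolding stage1[OF A] by (simp add: scaleR_conv_of_real algebra_simps)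
    also have "complex_of_real (expectation (\<lambda>\<omega>. cos (t * W \<omega> + 0)))
       + \<i> * complex_of_real (expectation (\<lambda>\<omega>. cos (t * W \<omega> + - (pi / 2))))
       = (\<integral>\<omega>. iexp (t * W \<omega>) \<partial>M)"
      unfolding ieq using ci[of t 0] ci[of t "- (pi / 2)"]
      by (subst Bochner_Integration.integral_add) (auto simp del: add_0_right)
    finally show "(\<integral>\<omega>. indicator A (X \<omega>) *\<^sub>R iexp (t * W \<omega>) \<partial>M)
      = expectation (\<lambda>\<omega>. indicator A (X \<omega>)) *\<^sub>R (\<integral>\<omega>. iexp (t * W \<omega>) \<partial>M)" .
  qed (auto simp: indicator_def)
  have pr: "expectation (\<lambda>\<omega>. indicator A (f \<omega>) :: real) = prob (f -` A \<inter> space M)"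
    if [measurable]: "f \<in> borel_measurable M" "A \<in> sets borel" for f :: "'a \<Rightarrow> real" and A
  proof -
    have "expectation (\<lambda>\<omega>. indicator A (f \<omega>) :: real) = expectation (indicator (f -` A \<inter> space M))"
      by (intro Bochner_Integration.integral_cong) (auto simp: indicator_def)
    also have "\<dots> = prob (f -` A \<inter> space M)" by simp
    finally show ?thesis .
  qed
  show ?thesis
    unfolding indep_var_eq
  proof (intro conjI indep_set_sigma_sets X W)
    show "Int_stable {X -` A \<inter> space M |A. A \<in> sets borel}"
      by (auto simp: Int_stable_def) (metis (no_types, lifting) sets.Int vimage_Int Int_assoc Int_commute Int_left_absorb)
    show "Int_stable {W -` A \<inter> space M |A. A \<in> sets borel}"
      by (auto simp: Int_stable_def) (metis (no_types, lifting) sets.Int vimage_Int Int_assoc Int_commute Int_left_absorb)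
    show "indep_set {X -` A \<inter> space M |A. A \<in> sets borel} {W -` A \<inter> space M |A. A \<in> sets borel}"
    proof (safe intro!: indep_setI)
      show "X -` A \<inter> space M \<in> events" if "A \<in> sets borel" for A
        using X that by (rule measurable_sets)
      show "W -` A \<inter> space M \<in> events" if "A \<in> sets borel" for A
        using W that by (rule measurable_sets)
    next
      fix A B :: "real set" assume [measurable]: "A \<in> sets borel" "B \<in> sets borel"
      have "prob ((X -` A \<inter> space M) \<inter> (W -` B \<inter> space M))
          = expectation (indicator ((X -` A \<inter> space M) \<inter> (W -` B \<inter> space M)))" by simp
      also have "\<dots> = expectation (\<lambda>\<omega>. indicator A (X \<omega>) * indicator B (W \<omega>))"
        by (intro Bochner_Integration.integral_cong) (auto simp: indicator_def)
      also have "\<dots> = prob (X -` A \<inter> space M) * prob (W -` B \<inter> space M)"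
        by (simp add: stage2 pr)
      finally show "prob ((X -` A \<inter> space M) \<inter> (W -` B \<inter> space M))
        = prob (X -` A \<inter> space M) * prob (W -` B \<inter> space M)" .
    qed
  qed
qed

section \<open>Centred Gaussian variables and pairs\<close>

text \<open>
  Residuals of a regression can vanish (for instance when \<open>X = V\<close>), so the degenerate law has to be
  carried along.
\<close>

lemma (in prob_space) centered_gaussian_cases:
  assumes gauss: "gaussian_rv M X" and mean: "expectation X = 0"
  obtains "AE \<omega> in M. X \<omega> = 0" "expectation (\<lambda>\<omega>. (X \<omega>)\<^sup>2) = 0"
  | \<sigma> where "\<sigma> > 0" "distributed M lborel X (normal_density 0 \<sigma>)" "expectation (\<lambda>\<omega>. (X \<omega>)\<^sup>2) = \<sigma>\<^sup>2"
proof -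
  from gauss have [measurable]: "X \<in> borel_measurable M" by (simp add: gaussian_rv_def)
  from gauss consider \<mu> where "AE \<omega> in M. X \<omega> = \<mu>"
    | \<mu> \<sigma> where "\<sigma> > 0" "distributed M lborel X (normal_density \<mu> \<sigma>)"
    unfolding gaussian_rv_def by blast
  then show ?thesis
  proof cases
    case 1
    have "expectation X = expectation (\<lambda>_. \<mu>)" using 1 by (intro integral_cong_AE) auto
    with mean have "\<mu> = 0" by (simp add: prob_space)
    with 1 have X0: "AE \<omega> in M. X \<omega> = 0" by simp
    have "expectation (\<lambda>\<omega>. (X \<omega>)\<^sup>2) = expectation (\<lambda>_. 0)"
      using X0 by (intro integral_cong_AE) auto
    with X0 show ?thesis using that(1) by simp
  next
    case 2
    have "\<mu> = 0" using normal_distributed_expectation[OF 2] mean by simp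
    with 2 show ?thesis
      using that(2)[of \<sigma>] normal_distributed_variance[OF 2] mean by simp
  qed
qed

lemma (in prob_space) char_centered_gaussian:
  assumes gauss: "gaussian_rv M X" and mean: "expectation X = 0"
  shows "(\<integral>\<omega>. iexp (t * X \<omega>) \<partial>M) = complex_of_real (exp (- (t\<^sup>2 * expectation (\<lambda>\<omega>. (X \<omega>)\<^sup>2)) / 2))"
  using gauss mean
proof (cases rule: centered_gaussian_cases)
  case 1
  from gauss have [measurable]: "X \<in> borel_measurable M" by (simp add: gaussian_rv_def)
  have "(\<integral>\<omega>. iexp (t * X \<omega>) \<partial>M) = (\<integral>\<omega>. 1 \<partial>M)"
    using 1(1) by (intro integral_cong_AE) auto
  then show ?thesis using 1(2) by (simp add: prob_space)
next
  case (2 \<sigma>)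
  from gauss have X[measurable]: "X \<in> borel_measurable M" by (simp add: gaussian_rv_def)
  have "distributed M lborel (\<lambda>\<omega>. (X \<omega> - 0) / \<sigma>) std_normal_density"
    using 2 normal_standard_normal_convert[of \<sigma> X 0] by simp
  then have "distr M lborel (\<lambda>\<omega>. X \<omega> / \<sigma>) = std_normal_distribution"
    using distributed_distr_eq_density by fastforce
  then have "(\<integral>y. iexp ((t * \<sigma>) * y) \<partial>distr M lborel (\<lambda>\<omega>. X \<omega> / \<sigma>)) = char std_normal_distribution (t * \<sigma>)"
    by (simp only: char_def)
  also have "(\<integral>y. iexp ((t * \<sigma>) * y) \<partial>distr M lborel (\<lambda>\<omega>. X \<omega> / \<sigma>)) = (\<integral>\<omega>. iexp ((t * \<sigma>) * (X \<omega> / \<sigma>)) \<partial>M)"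
    by (rule integral_distr) measurable
  also have "(\<lambda>\<omega>. iexp ((t * \<sigma>) * (X \<omega> / \<sigma>))) = (\<lambda>\<omega>. iexp (t * X \<omega>))"
    using 2(1) by simp
  finally show ?thesis using 2(3) by (simp add: char_std_normal_distribution power_mult_distrib)
qed

text \<open>
  Completing the square: exponential tilting of a normal density shifts its mean.
\<close>

lemma normal_density_times_exp:
  assumes "\<sigma> > 0"
  shows "normal_density 0 \<sigma> x * exp (a * x) = exp (a\<^sup>2 * \<sigma>\<^sup>2 / 2) * normal_density (a * \<sigma>\<^sup>2) \<sigma> x"
proof -
  have "- (x - 0)\<^sup>2 / (2 * \<sigma>\<^sup>2) + a * x = a\<^sup>2 * \<sigma>\<^sup>2 / 2 + - (x - a * \<sigma>\<^sup>2)\<^sup>2 / (2 * \<sigma>\<^sup>2)"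
    using assms by (simp add: field_simps power2_eq_square)
  then have "exp (- (x - 0)\<^sup>2 / (2 * \<sigma>\<^sup>2)) * exp (a * x)
      = exp (a\<^sup>2 * \<sigma>\<^sup>2 / 2) * exp (- (x - a * \<sigma>\<^sup>2)\<^sup>2 / (2 * \<sigma>\<^sup>2))"
    by (simp only: exp_add[symmetric])
  then show ?thesis by (simp add: normal_density_def)
qed

lemma (in prob_space) centered_gaussian_exp:
  assumes gauss: "gaussian_rv M X" and mean: "expectation X = 0"
  shows "integrable M (\<lambda>\<omega>. exp (a * X \<omega>))"
    and "expectation (\<lambda>\<omega>. exp (a * X \<omega>)) = exp (a\<^sup>2 * expectation (\<lambda>\<omega>. (X \<omega>)\<^sup>2) / 2)"
proof -
  from gauss have [measurable]: "X \<in> borel_measurable M" by (simp add: gaussian_rv_def)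
  have "integrable M (\<lambda>\<omega>. exp (a * X \<omega>)) \<and>
    expectation (\<lambda>\<omega>. exp (a * X \<omega>)) = exp (a\<^sup>2 * expectation (\<lambda>\<omega>. (X \<omega>)\<^sup>2) / 2)"
    using gauss mean
  proof (cases rule: centered_gaussian_cases)
    case 1
    have "integrable M (\<lambda>\<omega>. exp (a * X \<omega>)) \<longleftrightarrow> integrable M (\<lambda>\<omega>. 1 :: real)"
      using 1(1) by (intro integrable_cong_AE) auto
    moreover have "expectation (\<lambda>\<omega>. exp (a * X \<omega>)) = expectation (\<lambda>\<omega>. 1)"
      using 1(1) by (intro integral_cong_AE) auto
    ultimately show ?thesis using 1(2) by (simp add: prob_space)
  next
    case (2 \<sigma>)
    have "integrable lborel (\<lambda>x. normal_density 0 \<sigma> x * exp (a * x))"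
      unfolding normal_density_times_exp[OF 2(1)] using 2(1) by (intro integrable_mult_right) auto
    moreover have "(\<integral>x. normal_density 0 \<sigma> x * exp (a * x) \<partial>lborel) = exp (a\<^sup>2 * \<sigma>\<^sup>2 / 2)"
      unfolding normal_density_times_exp[OF 2(1)] using 2(1) by simp
    ultimately show ?thesis
      using distributed_integrable[OF 2(2), of "\<lambda>x. exp (a * x)"]
        distributed_integral[OF 2(2), of "\<lambda>x. exp (a * x)"] 2(3)
      by simp
  qed
  then show "integrable M (\<lambda>\<omega>. exp (a * X \<omega>))"
    and "expectation (\<lambda>\<omega>. exp (a * X \<omega>)) = exp (a\<^sup>2 * expectation (\<lambda>\<omega>. (X \<omega>)\<^sup>2) / 2)"
    by blast+
qed

text \<open>
  The bound depends on an upper bound \<open>v\<close> of the variance only, so that it is uniform over all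
  residuals, whose variances vary from pair to pair.
\<close>

lemma (in prob_space) centered_gaussian_exp_abs:
  assumes gauss: "gaussian_rv M X" and mean: "expectation X = 0"
    and v: "expectation (\<lambda>\<omega>. (X \<omega>)\<^sup>2) \<le> v"
  shows "integrable M (\<lambda>\<omega>. exp (a * \<bar>X \<omega>\<bar>))"
    and "expectation (\<lambda>\<omega>. exp (a * \<bar>X \<omega>\<bar>)) \<le> 2 * exp (a\<^sup>2 * v / 2)"
proof -
  from gauss have [measurable]: "X \<in> borel_measurable M" by (simp add: gaussian_rv_def)
  note e = centered_gaussian_exp[OF gauss mean]
  have int2: "integrable M (\<lambda>\<omega>. exp (a * X \<omega>) + exp (- a * X \<omega>))"
    by (intro Bochner_Integration.integrable_add e(1))
  have le: "exp (a * \<bar>X \<omega>\<bar>) \<le> exp (a * X \<omega>) + exp (- a * X \<omega>)" for \<omega>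
    by (cases "X \<omega> \<ge> 0") (auto simp: abs_if)
  show int: "integrable M (\<lambda>\<omega>. exp (a * \<bar>X \<omega>\<bar>))"
    by (rule Bochner_Integration.integrable_bound[OF int2]) (use le in \<open>auto intro!: AE_I2 simp: add_pos_pos\<close>)
  have "expectation (\<lambda>\<omega>. exp (a * \<bar>X \<omega>\<bar>)) \<le> expectation (\<lambda>\<omega>. exp (a * X \<omega>) + exp (- a * X \<omega>))"
    by (intro integral_mono int int2 le)
  also have "\<dots> = 2 * exp (a\<^sup>2 * expectation (\<lambda>\<omega>. (X \<omega>)\<^sup>2) / 2)"
    by (subst Bochner_Integration.integral_add[OF e(1) e(1)]) (simp only: e(2), simp)
  also have "\<dots> \<le> 2 * exp (a\<^sup>2 * v / 2)" using v by (simp add: mult_left_mono)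
  finally show "expectation (\<lambda>\<omega>. exp (a * \<bar>X \<omega>\<bar>)) \<le> 2 * exp (a\<^sup>2 * v / 2)" .
qed

lemma integrable_product_of_squares:
  fixes f g :: "'a \<Rightarrow> real"
  assumes [measurable]: "f \<in> borel_measurable M" "g \<in> borel_measurable M"
    and f2: "integrable M (\<lambda>x. (f x)\<^sup>2)" and g2: "integrable M (\<lambda>x. (g x)\<^sup>2)"
  shows "integrable M (\<lambda>x. f x * g x)"
proof (rule Bochner_Integration.integrable_bound[OF Bochner_Integration.integrable_add[OF f2 g2]])
  have "\<bar>f x * g x\<bar> \<le> (f x)\<^sup>2 + (g x)\<^sup>2" for x
  proof -
    have "2 * \<bar>f x * g x\<bar> \<le> (f x)\<^sup>2 + (g x)\<^sup>2"
      using sum_squares_bound[of "\<bar>f x\<bar>" "\<bar>g x\<bar>"] by (simp add: abs_mult)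
    then show ?thesis using abs_ge_zero[of "f x * g x"] by linarith
  qed
  then show "AE x in M. norm (f x * g x) \<le> norm ((f x)\<^sup>2 + (g x)\<^sup>2)"
    by (auto intro!: AE_I2)
qed measurable

text \<open>
  Joint normality is expressed through linear combinations, as in \<open>gaussian_process\<close>; the
  characteristic function of the pair is then a function of its second moments.
\<close>

definition gaussian_pair :: "'w measure \<Rightarrow> ('w \<Rightarrow> real) \<Rightarrow> ('w \<Rightarrow> real) \<Rightarrow> bool" where
  "gaussian_pair M X V \<longleftrightarrow> (\<forall>a b. gaussian_rv M (\<lambda>\<omega>. a * X \<omega> + b * V \<omega>)) \<and>
     (\<forall>U\<in>{X, V}. integrable M U \<and> integral\<^sup>L M U = 0 \<and> integrable M (\<lambda>\<omega>. (U \<omega>)\<^sup>2))"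

lemma gaussian_pairD:
  assumes "gaussian_pair M X V"
  shows "gaussian_rv M (\<lambda>\<omega>. a * X \<omega> + b * V \<omega>)" "gaussian_rv M X" "gaussian_rv M V"
    "integrable M X" "integrable M V" "integral\<^sup>L M X = 0" "integral\<^sup>L M V = 0"
    "integrable M (\<lambda>\<omega>. (X \<omega>)\<^sup>2)" "integrable M (\<lambda>\<omega>. (V \<omega>)\<^sup>2)"
    "integrable M (\<lambda>\<omega>. X \<omega> * V \<omega>)"
    "X \<in> borel_measurable M" "V \<in> borel_measurable M"
proof -
  have g: "gaussian_rv M (\<lambda>\<omega>. a * X \<omega> + b * V \<omega>)" for a b
    using assms by (simp add: gaussian_pair_def)
  then show "gaussian_rv M (\<lambda>\<omega>. a * X \<omega> + b * V \<omega>)" .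
  show X: "gaussian_rv M X" and V: "gaussian_rv M V" using g[of 1 0] g[of 0 1] by simp_all
  show "integrable M X" "integrable M V" "integral\<^sup>L M X = 0" "integral\<^sup>L M V = 0"
    and sq: "integrable M (\<lambda>\<omega>. (X \<omega>)\<^sup>2)" "integrable M (\<lambda>\<omega>. (V \<omega>)\<^sup>2)"
    using assms by (auto simp: gaussian_pair_def)
  show m: "X \<in> borel_measurable M" "V \<in> borel_measurable M"
    using X V by (auto simp: gaussian_rv_def)
  show "integrable M (\<lambda>\<omega>. X \<omega> * V \<omega>)" by (rule integrable_product_of_squares[OF m sq])
qed

text \<open>
  The residual \<open>W\<close> is uncorrelated with \<open>X\<close>. Since \<open>a * X + b * W\<close> is again a combination of \<open>X\<close> and \<open>V\<close>, it
  is centred Gaussian with variance \<open>a\<^sup>2 * E (X * X) + b\<^sup>2 * E (W * W)\<close>, and so its characteristic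
  function is a product.
\<close>

lemma (in prob_space) gaussian_regression_residual:
  assumes P: "gaussian_pair M X V" and pos: "expectation (\<lambda>\<omega>. (X \<omega>)\<^sup>2) > 0"
  defines "\<rho> \<equiv> expectation (\<lambda>\<omega>. X \<omega> * V \<omega>) / expectation (\<lambda>\<omega>. (X \<omega>)\<^sup>2)"
  defines "W \<equiv> \<lambda>\<omega>. V \<omega> - \<rho> * X \<omega>"
  shows "indep_var borel X borel W" and "gaussian_rv M W" and "expectation W = 0"
    and "expectation (\<lambda>\<omega>. (W \<omega>)\<^sup>2)
      = expectation (\<lambda>\<omega>. (V \<omega>)\<^sup>2) - \<rho>\<^sup>2 * expectation (\<lambda>\<omega>. (X \<omega>)\<^sup>2)"
proof -
  note D = gaussian_pairD[OF P]
  note [measurable] = D(11,12)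
  define x2 xv v2 where "x2 = expectation (\<lambda>\<omega>. (X \<omega>)\<^sup>2)" and "xv = expectation (\<lambda>\<omega>. X \<omega> * V \<omega>)"
    and "v2 = expectation (\<lambda>\<omega>. (V \<omega>)\<^sup>2)"
  have xv: "xv = \<rho> * x2" using pos by (simp add: \<rho>_def x2_def xv_def)
  have mean: "expectation (\<lambda>\<omega>. a * X \<omega> + b * V \<omega>) = 0" for a b
    using D by simp
  have second: "expectation (\<lambda>\<omega>. (a * X \<omega> + b * V \<omega>)\<^sup>2) = a\<^sup>2 * x2 + 2 * a * b * xv + b\<^sup>2 * v2" for a b
  proof -
    have "expectation (\<lambda>\<omega>. (a * X \<omega> + b * V \<omega>)\<^sup>2)
        = expectation (\<lambda>\<omega>. a\<^sup>2 * (X \<omega>)\<^sup>2 + (2 * a * b) * (X \<omega> * V \<omega>) + b\<^sup>2 * (V \<omega>)\<^sup>2)"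
      by (intro Bochner_Integration.integral_cong) (auto simp: power2_eq_square algebra_simps)
    then show ?thesis using D by (simp add: x2_def xv_def v2_def)
  qed
  have W_eq: "W = (\<lambda>\<omega>. (- \<rho>) * X \<omega> + 1 * V \<omega>)" by (simp add: W_def fun_eq_iff)
  show gW: "gaussian_rv M W" unfolding W_eq by (rule D(1))
  then have [measurable]: "W \<in> borel_measurable M" by (simp add: gaussian_rv_def)
  show mW: "expectation W = 0" unfolding W_eq by (rule mean)
  have w2: "expectation (\<lambda>\<omega>. (W \<omega>)\<^sup>2) = v2 - \<rho>\<^sup>2 * x2"
    unfolding W_eq second xv by (simp add: power2_eq_square algebra_simps)
  then show "expectation (\<lambda>\<omega>. (W \<omega>)\<^sup>2)
      = expectation (\<lambda>\<omega>. (V \<omega>)\<^sup>2) - \<rho>\<^sup>2 * expectation (\<lambda>\<omega>. (X \<omega>)\<^sup>2)"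
    by (simp add: v2_def x2_def)
  show "indep_var borel X borel W"
  proof (rule indep_var_if_char_factors)
    fix a b
    have comb: "(\<lambda>\<omega>. a * X \<omega> + b * W \<omega>) = (\<lambda>\<omega>. (a - b * \<rho>) * X \<omega> + b * V \<omega>)"
      by (simp add: W_def fun_eq_iff algebra_simps)
    have "(\<integral>\<omega>. iexp (1 * (a * X \<omega> + b * W \<omega>)) \<partial>M)
        = complex_of_real (exp (- (1\<^sup>2 * expectation (\<lambda>\<omega>. (a * X \<omega> + b * W \<omega>)\<^sup>2)) / 2))"
      using char_centered_gaussian[of "\<lambda>\<omega>. a * X \<omega> + b * W \<omega>" 1] D(1) mean unfolding comb by blast
    also have "expectation (\<lambda>\<omega>. (a * X \<omega> + b * W \<omega>)\<^sup>2) = a\<^sup>2 * x2 + b\<^sup>2 * (v2 - \<rho>\<^sup>2 * x2)"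
      unfolding fun_cong[OF comb] second xv by (simp add: power2_eq_square algebra_simps)
    also have "exp (- (1\<^sup>2 * (a\<^sup>2 * x2 + b\<^sup>2 * (v2 - \<rho>\<^sup>2 * x2))) / 2)
        = exp (- (a\<^sup>2 * x2) / 2) * exp (- (b\<^sup>2 * (v2 - \<rho>\<^sup>2 * x2)) / 2)"
      by (simp add: field_simps flip: exp_add)
    finally show "(\<integral>\<omega>. iexp (a * X \<omega> + b * W \<omega>) \<partial>M)
      = (\<integral>\<omega>. iexp (a * X \<omega>) \<partial>M) * (\<integral>\<omega>. iexp (b * W \<omega>) \<partial>M)"
      unfolding char_centered_gaussian[OF gW mW] char_centered_gaussian[OF D(2,6)] w2
      by (simp only: x2_def of_real_mult mult_1)
  qed measurable
qed

lemma gaussian_process_pair: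
  assumes "gaussian_process M Z" "zero_mean M Z" "has_stationary_covariance M Z k"
  shows "gaussian_pair M (Z x) (Z y)"
proof -
  have "gaussian_rv M (\<lambda>\<omega>. a * Z x \<omega> + b * Z y \<omega>)" for a b
  proof (cases "x = y")
    case True
    have "gaussian_rv M (\<lambda>\<omega>. \<Sum>u\<in>{x}. (a + b) * Z u \<omega>)"
      by (rule assms(1)[unfolded gaussian_process_def, rule_format]) simp
    then show ?thesis using True by (simp add: algebra_simps)
  next
    case False
    have "gaussian_rv M (\<lambda>\<omega>. \<Sum>u\<in>{x, y}. (if u = x then a else b) * Z u \<omega>)"
      by (rule assms(1)[unfolded gaussian_process_def, rule_format]) simp
    then show ?thesis using False by simp
  qed
  then show ?thesis
    using assms(2,3) by (auto simp: gaussian_pair_def zero_mean_def has_stationary_covariance_def)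
qed

section \<open>Transformed Gaussian variables\<close>

lemma increment_bound_if_exp_deriv:
  fixes F :: "real \<Rightarrow> real"
  assumes F: "F differentiable_on UNIV" and C: "\<And>t. \<bar>deriv F t\<bar> \<le> C * exp (C * \<bar>t\<bar>)"
  shows "\<bar>F (w + h) - F w\<bar> \<le> C * exp (C * (\<bar>w\<bar> + \<bar>h\<bar>)) * \<bar>h\<bar>"
proof -
  have C0: "C \<ge> 0" using order_trans[OF abs_ge_zero C[of 0]] by simp
  define R where "R = \<bar>w\<bar> + \<bar>h\<bar>"
  have "norm (F (w + h) - F w) \<le> C * exp (C * R) * norm ((w + h) - w)"
  proof (rule field_differentiable_bound[where S = "{- R..R}" and f' = "deriv F"])
    fix t assume t: "t \<in> {- R..R}"
    have "F differentiable at t" using F by (simp add: differentiable_on_def)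
    then show "(F has_field_derivative deriv F t) (at t within {- R..R})"
      using DERIV_deriv_iff_real_differentiable has_field_derivative_at_within by blast
    have "C * exp (C * \<bar>t\<bar>) \<le> C * exp (C * R)"
      using t C0 by (intro mult_left_mono) (auto intro!: mult_left_mono)
    then show "norm (deriv F t) \<le> C * exp (C * R)" using C[of t] by simp
  qed (auto simp: R_def)
  then show ?thesis by (simp add: R_def)
qed

lemma (in prob_space) integrable_if_exp_growth:
  fixes f :: "real \<Rightarrow> real"
  assumes X: "gaussian_rv M X" "expectation X = 0"
    and f[measurable]: "f \<in> borel_measurable borel" and growth: "\<And>t. \<bar>f t\<bar> \<le> C * exp (a * \<bar>t\<bar>)"
  shows "integrable M (\<lambda>\<omega>. f (X \<omega>))"
proof -
  from X have [measurable]: "X \<in> borel_measurable M" by (simp add: gaussian_rv_def)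
  have "integrable M (\<lambda>\<omega>. C * exp (a * \<bar>X \<omega>\<bar>))"
    by (intro integrable_mult_right centered_gaussian_exp_abs(1)[OF X order_refl])
  then show ?thesis
  proof (rule Bochner_Integration.integrable_bound)
    show "AE \<omega> in M. norm (f (X \<omega>)) \<le> norm (C * exp (a * \<bar>X \<omega>\<bar>))"
      using order_trans[OF growth abs_ge_self] by (intro AE_I2) simp
  qed measurable
qed

text \<open>
  Write \<open>V = \<rho> X + W\<close>; the part \<open>f X * W\<close> has mean zero by independence. The point is that the
  dependence on \<open>V\<close> is only through its covariance with \<open>X\<close>.
\<close>

lemma (in prob_space) gaussian_transform_cross_covariance:
  fixes f :: "real \<Rightarrow> real"
  assumes P: "gaussian_pair M X V" and pos: "expectation (\<lambda>\<omega>. (X \<omega>)\<^sup>2) > 0"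
    and f[measurable]: "f \<in> borel_measurable borel" and growth: "\<And>t. \<bar>f t\<bar> \<le> C * exp (C * \<bar>t\<bar>)"
  shows "expectation (\<lambda>\<omega>. f (X \<omega>) * V \<omega>)
    = expectation (\<lambda>\<omega>. X \<omega> * V \<omega>) / expectation (\<lambda>\<omega>. (X \<omega>)\<^sup>2) * expectation (\<lambda>\<omega>. f (X \<omega>) * X \<omega>)"
proof -
  note D = gaussian_pairD[OF P]
  note [measurable] = D(11,12)
  define \<rho> where "\<rho> = expectation (\<lambda>\<omega>. X \<omega> * V \<omega>) / expectation (\<lambda>\<omega>. (X \<omega>)\<^sup>2)"
  define W where "W \<omega> = V \<omega> - \<rho> * X \<omega>" for \<omega>
  note R = gaussian_regression_residual[OF P pos, folded \<rho>_def, folded W_def]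
  have C: "C \<ge> 0" using order_trans[OF abs_ge_zero growth[of 0]] by simp
  have fX: "integrable M (\<lambda>\<omega>. f (X \<omega>))"
    by (rule integrable_if_exp_growth[OF D(2,6) f growth])
  have "\<bar>f t * t\<bar> \<le> C * exp ((C + 1) * \<bar>t\<bar>)" for t
  proof -
    have "\<bar>t\<bar> \<le> exp \<bar>t\<bar>" using exp_ge_add_one_self[of "\<bar>t\<bar>"] by linarith
    then have "\<bar>f t\<bar> * \<bar>t\<bar> \<le> (C * exp (C * \<bar>t\<bar>)) * exp \<bar>t\<bar>"
      using growth[of t] C by (intro mult_mono) auto
    then show ?thesis by (simp add: abs_mult distrib_right exp_add)
  qed
  then have fXX: "integrable M (\<lambda>\<omega>. f (X \<omega>) * X \<omega>)"
    by (intro integrable_if_exp_growth[OF D(2,6), where f = "\<lambda>t. f t * t"]) auto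
  have Wi: "integrable M W" using D(4,5) unfolding W_def by simp
  have "indep_var borel (f \<circ> X) borel ((\<lambda>x. x) \<circ> W)"
    by (rule indep_var_compose[OF R(1)]) auto
  then have ind: "indep_var borel (\<lambda>\<omega>. f (X \<omega>)) borel W" by (simp add: comp_def)
  have "expectation (\<lambda>\<omega>. f (X \<omega>) * V \<omega>)
      = expectation (\<lambda>\<omega>. f (X \<omega>) * W \<omega> + \<rho> * (f (X \<omega>) * X \<omega>))"
    by (simp add: W_def algebra_simps)
  also have "\<dots> = expectation (\<lambda>\<omega>. f (X \<omega>) * W \<omega>) + \<rho> * expectation (\<lambda>\<omega>. f (X \<omega>) * X \<omega>)"
    using indep_var_integrable[OF ind fX Wi] fXX by simp
  also have "expectation (\<lambda>\<omega>. f (X \<omega>) * W \<omega>) = 0"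
    using indep_var_lebesgue_integral[OF ind fX Wi] R(3) by simp
  finally show ?thesis by (simp add: \<rho>_def)
qed

text \<open>
  With \<open>V = W + \<rho> X\<close> and \<open>E (f X * f W) = 0\<close> the covariance is the mean of
  \<open>f X * (f (W + \<rho> X) - f W)\<close>, which contains the factor \<open>\<rho>\<close>. What remains is bounded by
  exponentials of \<open>\<bar>X\<bar>\<close> and \<open>\<bar>W\<bar>\<close>, whose means are bounded in terms of \<open>C\<close> and the common variance \<open>v\<close>
  alone. The constant thus is the same for all pairs.
\<close>

lemma (in prob_space) gaussian_transform_covariance_bound:
  fixes f :: "real \<Rightarrow> real"
  assumes P: "gaussian_pair M X V" and pos: "v > 0"
    and vX: "expectation (\<lambda>\<omega>. (X \<omega>)\<^sup>2) = v" and vV: "expectation (\<lambda>\<omega>. (V \<omega>)\<^sup>2) = v"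
    and f[measurable]: "f \<in> borel_measurable borel" and growth: "\<And>t. \<bar>f t\<bar> \<le> C * exp (C * \<bar>t\<bar>)"
    and lip: "\<And>w h. \<bar>f (w + h) - f w\<bar> \<le> C * exp (C * (\<bar>w\<bar> + \<bar>h\<bar>)) * \<bar>h\<bar>"
    and mean: "expectation (\<lambda>\<omega>. f (X \<omega>)) = 0"
  shows "\<bar>expectation (\<lambda>\<omega>. f (X \<omega>) * f (V \<omega>))\<bar> \<le> \<bar>expectation (\<lambda>\<omega>. X \<omega> * V \<omega>)\<bar> / v *
    (C\<^sup>2 * (2 * exp ((2 * (2 * C + 1))\<^sup>2 * v / 2) + 2 * exp ((2 * C)\<^sup>2 * v / 2)))"
proof -
  note D = gaussian_pairD[OF P]
  note [measurable] = D(11,12)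
  have vpos: "expectation (\<lambda>\<omega>. (X \<omega>)\<^sup>2) > 0" using pos vX by simp
  define \<rho> where "\<rho> = expectation (\<lambda>\<omega>. X \<omega> * V \<omega>) / expectation (\<lambda>\<omega>. (X \<omega>)\<^sup>2)"
  define W where "W \<omega> = V \<omega> - \<rho> * X \<omega>" for \<omega>
  note R = gaussian_regression_residual[OF P vpos, folded \<rho>_def, folded W_def]
  from R(2) have [measurable]: "W \<in> borel_measurable M" by (simp add: gaussian_rv_def)
  have C: "C \<ge> 0" using order_trans[OF abs_ge_zero growth[of 0]] by simp
  have w2: "expectation (\<lambda>\<omega>. (W \<omega>)\<^sup>2) = v - \<rho>\<^sup>2 * v" using R(4) by (simp add: vX vV)
  have w2v: "expectation (\<lambda>\<omega>. (W \<omega>)\<^sup>2) \<le> v" using w2 pos by simp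
  have "0 \<le> v - \<rho>\<^sup>2 * v" unfolding w2[symmetric] by simp
  then have "\<rho>\<^sup>2 \<le> 1" using pos by simp
  then have rho1: "\<bar>\<rho>\<bar> \<le> 1" by (simp add: abs_square_le_1)
  have fX: "integrable M (\<lambda>\<omega>. f (X \<omega>))" by (rule integrable_if_exp_growth[OF D(2,6) f growth])
  have fW: "integrable M (\<lambda>\<omega>. f (W \<omega>))" by (rule integrable_if_exp_growth[OF R(2,3) f growth])
  have "indep_var borel (f \<circ> X) borel (f \<circ> W)"
    by (rule indep_var_compose[OF R(1)]) auto
  then have ind: "indep_var borel (\<lambda>\<omega>. f (X \<omega>)) borel (\<lambda>\<omega>. f (W \<omega>))" by (simp add: comp_def)
  have zero: "expectation (\<lambda>\<omega>. f (X \<omega>) * f (W \<omega>)) = 0"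
    using indep_var_lebesgue_integral[OF ind fX fW] mean by simp
  \<comment> \<open>a sum instead of a product of exponentials, by \<open>p * q \<le> p\<^sup>2 + q\<^sup>2\<close>, which doubles the exponents\<close>
  define G where "G \<omega> = exp (2 * (2 * C + 1) * \<bar>X \<omega>\<bar>) + exp (2 * C * \<bar>W \<omega>\<bar>)" for \<omega>
  note eX = centered_gaussian_exp_abs[OF D(2,6) eq_refl[OF vX]]
  note eW = centered_gaussian_exp_abs[OF R(2,3) w2v]
  have Gi: "integrable M G" unfolding G_def by (intro Bochner_Integration.integrable_add eX(1) eW(1))
  have EG: "expectation G \<le> 2 * exp ((2 * (2 * C + 1))\<^sup>2 * v / 2) + 2 * exp ((2 * C)\<^sup>2 * v / 2)"
    unfolding G_def by (subst Bochner_Integration.integral_add[OF eX(1) eW(1)]) (intro add_mono eX(2) eW(2))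
  have bound: "\<bar>f (X \<omega>) * (f (V \<omega>) - f (W \<omega>))\<bar> \<le> \<bar>\<rho>\<bar> * C\<^sup>2 * G \<omega>" for \<omega>
  proof -
    define x w where "x = \<bar>X \<omega>\<bar>" and "w = \<bar>W \<omega>\<bar>"
    have x0: "x \<ge> 0" "w \<ge> 0" by (simp_all add: x_def w_def)
    have V: "V \<omega> = W \<omega> + \<rho> * X \<omega>" by (simp add: W_def)
    have "\<bar>f (V \<omega>) - f (W \<omega>)\<bar> \<le> C * exp (C * (w + \<bar>\<rho>\<bar> * x)) * (\<bar>\<rho>\<bar> * x)"
      unfolding V using lip[of "W \<omega>" "\<rho> * X \<omega>"] by (simp add: x_def w_def abs_mult)
    also have "\<dots> \<le> C * exp (C * (w + x)) * (\<bar>\<rho>\<bar> * exp x)"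
    proof (intro mult_mono mult_left_mono)
      have "\<bar>\<rho>\<bar> * x \<le> x" using rho1 x0 by (simp add: mult_left_le_one_le)
      then show "exp (C * (w + \<bar>\<rho>\<bar> * x)) \<le> exp (C * (w + x))"
        using C by (simp add: mult_left_mono)
      show "x \<le> exp x" using exp_ge_add_one_self[of x] by linarith
    qed (use C x0 in auto)
    finally have "\<bar>f (X \<omega>) * (f (V \<omega>) - f (W \<omega>))\<bar>
        \<le> (C * exp (C * x)) * (C * exp (C * (w + x)) * (\<bar>\<rho>\<bar> * exp x))"
      using growth[of "X \<omega>"] C unfolding abs_mult x_def by (intro mult_mono) auto
    also have "\<dots> = \<bar>\<rho>\<bar> * C\<^sup>2 * (exp ((2 * C + 1) * x) * exp (C * w))"
    proof -
      have "exp ((2 * C + 1) * x) = exp (C * x) * exp (C * x) * exp x"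
        by (simp add: algebra_simps flip: exp_add)
      then show ?thesis by (simp add: power2_eq_square distrib_left exp_add)
    qed
    also have "exp ((2 * C + 1) * x) * exp (C * w) \<le> G \<omega>"
    proof -
      define p q where "p = exp ((2 * C + 1) * x)" and "q = exp (C * w)"
      have "2 * (p * q) \<le> p\<^sup>2 + q\<^sup>2" using sum_squares_bound[of p q] by simp
      moreover have "p * q \<ge> 0" by (simp add: p_def q_def)
      moreover have "p\<^sup>2 + q\<^sup>2 = G \<omega>"
        by (simp add: p_def q_def G_def x_def w_def mult.assoc flip: exp_double)
      ultimately show ?thesis unfolding p_def q_def by linarith
    qed
    finally show ?thesis using C by (simp add: mult_left_mono)
  qed
  have bi: "integrable M (\<lambda>\<omega>. \<bar>\<rho>\<bar> * C\<^sup>2 * G \<omega>)" using Gi by simp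
  have di: "integrable M (\<lambda>\<omega>. f (X \<omega>) * (f (V \<omega>) - f (W \<omega>)))"
  proof (rule Bochner_Integration.integrable_bound[OF bi])
    show "AE \<omega> in M. norm (f (X \<omega>) * (f (V \<omega>) - f (W \<omega>))) \<le> norm (\<bar>\<rho>\<bar> * C\<^sup>2 * G \<omega>)"
      using order_trans[OF bound abs_ge_self] by (intro AE_I2) simp
  qed measurable
  have "expectation (\<lambda>\<omega>. f (X \<omega>) * f (V \<omega>))
      = expectation (\<lambda>\<omega>. f (X \<omega>) * (f (V \<omega>) - f (W \<omega>)) + f (X \<omega>) * f (W \<omega>))"
    by (simp add: algebra_simps)
  also have "\<dots> = expectation (\<lambda>\<omega>. f (X \<omega>) * (f (V \<omega>) - f (W \<omega>)))"
    using di indep_var_integrable[OF ind fX fW] zero by simp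
  finally have "\<bar>expectation (\<lambda>\<omega>. f (X \<omega>) * f (V \<omega>))\<bar>
      \<le> expectation (\<lambda>\<omega>. \<bar>f (X \<omega>) * (f (V \<omega>) - f (W \<omega>))\<bar>)" by simp
  also have "\<dots> \<le> expectation (\<lambda>\<omega>. \<bar>\<rho>\<bar> * C\<^sup>2 * G \<omega>)"
    using di by (intro integral_mono bi bound) auto
  also have "\<dots> = \<bar>\<rho>\<bar> * C\<^sup>2 * expectation G" by simp
  also have "\<dots> \<le> \<bar>\<rho>\<bar> * C\<^sup>2 * (2 * exp ((2 * (2 * C + 1))\<^sup>2 * v / 2) + 2 * exp ((2 * C)\<^sup>2 * v / 2))"
    by (intro mult_left_mono EG) auto
  also have "\<bar>\<rho>\<bar> = \<bar>expectation (\<lambda>\<omega>. X \<omega> * V \<omega>)\<bar> / v" using pos by (simp add: \<rho>_def vX)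
  finally show ?thesis by (simp only: mult.assoc)
qed

text \<open>
  The mean is an integral against the normal density of variance \<open>v\<close>, hence the same number \<open>m\<close> for
  all such variables. As \<open>E X = 0\<close>, \<open>m\<close> is also the mean of \<open>(f X - f 0) * X\<close>, which is nonnegative
  by monotonicity; and it is positive on an interval beyond any point where \<open>f\<close> differs from \<open>f 0\<close>.
\<close>

lemma (in prob_space) gaussian_transform_slope:
  fixes f :: "real \<Rightarrow> real"
  assumes "v > 0" and f: "continuous_on UNIV f" and mono: "mono f" and nc: "\<not> f constant_on UNIV"
    and growth: "\<And>t. \<bar>f t\<bar> \<le> C * exp (C * \<bar>t\<bar>)"
  obtains m where "m > 0"
    and "\<And>X. gaussian_rv M X \<Longrightarrow> expectation X = 0 \<Longrightarrow> expectation (\<lambda>\<omega>. (X \<omega>)\<^sup>2) = v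
      \<Longrightarrow> expectation (\<lambda>\<omega>. f (X \<omega>) * X \<omega>) = m"
proof -
  define \<sigma> where "\<sigma> = sqrt v"
  have sg: "\<sigma> > 0" and sg2: "\<sigma>\<^sup>2 = v" using \<open>v > 0\<close> by (simp_all add: \<sigma>_def)
  define D where "D = normal_density 0 \<sigma>"
  have D0: "D x > 0" for x unfolding D_def by (rule normal_density_pos[OF sg])
  have [measurable]: "D \<in> borel_measurable borel" by (simp add: D_def)
  have fm[measurable]: "f \<in> borel_measurable borel" by (rule borel_measurable_continuous_onI[OF f])
  define m where "m = (\<integral>x. D x * (f x * x) \<partial>lborel)"
  have C: "C \<ge> 0" using order_trans[OF abs_ge_zero growth[of 0]] by simp
  have Dexp: "integrable lborel (\<lambda>x. D x * exp (a * x))" for a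
    unfolding D_def normal_density_times_exp[OF sg] using sg by (intro integrable_mult_right) auto
  have Di: "integrable lborel (\<lambda>x. D x * (f x * x))"
  proof (rule Bochner_Integration.integrable_bound)
    show "integrable lborel (\<lambda>x. C * (D x * exp ((C + 1) * x) + D x * exp ((- C - 1) * x)))"
      by (intro integrable_mult_right Bochner_Integration.integrable_add Dexp)
    have Db: "\<bar>D x * (f x * x)\<bar> \<le> C * (D x * exp ((C + 1) * x) + D x * exp ((- C - 1) * x))" for x
    proof -
      have "\<bar>x\<bar> \<le> exp \<bar>x\<bar>" using exp_ge_add_one_self[of "\<bar>x\<bar>"] by linarith
      then have "\<bar>f x\<bar> * \<bar>x\<bar> \<le> (C * exp (C * \<bar>x\<bar>)) * exp \<bar>x\<bar>"
        using growth[of x] C by (intro mult_mono) auto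
      also have "\<dots> = C * exp ((C + 1) * \<bar>x\<bar>)" by (simp add: distrib_right exp_add)
      also have "\<dots> \<le> C * (exp ((C + 1) * x) + exp ((- C - 1) * x))"
      proof (intro mult_left_mono C)
        show "exp ((C + 1) * \<bar>x\<bar>) \<le> exp ((C + 1) * x) + exp ((- C - 1) * x)"
        proof -
          have "(C + 1) * \<bar>x\<bar> = (C + 1) * x \<or> (C + 1) * \<bar>x\<bar> = (- C - 1) * x"
            by (cases "x \<ge> 0") (auto simp: algebra_simps)
          then show ?thesis
            by (elim disjE) (simp_all only: le_add_same_cancel1 le_add_same_cancel2 exp_ge_zero)
        qed
      qed
      finally have "D x * (\<bar>f x\<bar> * \<bar>x\<bar>) \<le> D x * (C * (exp ((C + 1) * x) + exp ((- C - 1) * x)))"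
        using D0[of x] by (intro mult_left_mono) auto
      then show ?thesis using D0[of x] by (simp add: abs_mult algebra_simps)
    qed
    show "AE x in lborel. norm (D x * (f x * x))
        \<le> norm (C * (D x * exp ((C + 1) * x) + D x * exp ((- C - 1) * x)))"
      by (intro AE_I2) (simp only: real_norm_def order_trans[OF Db abs_ge_self])
  qed measurable
  have D1: "integrable lborel (\<lambda>x. D x * x)" "(\<integral>x. D x * x \<partial>lborel) = 0"
    unfolding D_def using integrable_normal_moment_nz_1[OF sg] integral_normal_moment_nz_1[OF sg] by auto
  define g where "g x = D x * ((f x - f 0) * x)" for x
  have g_eq: "g x = D x * (f x * x) - f 0 * (D x * x)" for x by (simp add: g_def algebra_simps)
  have gi: "integrable lborel g" unfolding g_eq using Di D1 by simp
  have m_eq: "m = (\<integral>x. g x \<partial>lborel)"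
    unfolding g_eq m_def using Di D1 by simp
  have fx: "(f x - f 0) * x \<ge> 0" for x
    using monoD[OF mono, of 0 x] monoD[OF mono, of x 0]
    by (cases "x \<ge> 0") (auto intro: mult_nonneg_nonneg mult_nonpos_nonpos)
  have g0: "g x \<ge> 0" for x unfolding g_def using D0[of x] fx[of x] by simp
  have "m \<noteq> 0"
  proof
    assume "m = 0"
    then have AE0: "AE x in lborel. g x = 0"
      using integral_nonneg_eq_0_iff_AE[OF gi] g0 m_eq by simp
    obtain x0 where x0: "f x0 \<noteq> f 0"
      using nc by (auto simp: constant_on_def)
    have "\<exists>a. \<forall>x\<in>{a..a + 1}. f x \<noteq> f 0 \<and> x \<noteq> 0"
    proof (cases "x0 > 0")
      case True
      then have "f 0 < f x0" using x0 monoD[OF mono, of 0 x0] by simp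
      then show ?thesis using True monoD[OF mono, of x0] by (intro exI[of _ x0]) force
    next
      case False
      then have "x0 < 0" using x0 by (cases "x0 = 0") auto
      moreover have "f x0 < f 0" using x0 monoD[OF mono, of x0 0] \<open>x0 < 0\<close> by simp
      ultimately show ?thesis using monoD[OF mono, of _ x0] by (intro exI[of _ "x0 - 1"]) force
    qed
    then obtain a where a: "\<And>x. x \<in> {a..a + 1} \<Longrightarrow> f x \<noteq> f 0 \<and> x \<noteq> 0" by blast
    have "g x \<noteq> 0" if "x \<in> {a..a + 1}" for x
      unfolding g_def using a[OF that] D0[of x] by simp
    with AE0 have "AE x in lborel. x \<notin> {a..a + 1}" by (auto elim!: eventually_mono)
    then have "{a..a + 1} \<in> null_sets lborel" by (subst AE_iff_null_sets) auto
    then show False by (simp add: null_sets_def)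
  qed
  moreover have "m \<ge> 0" unfolding m_eq using g0 by simp
  ultimately have "m > 0" by simp
  moreover have "expectation (\<lambda>\<omega>. f (X \<omega>) * X \<omega>) = m"
    if X: "gaussian_rv M X" "expectation X = 0" "expectation (\<lambda>\<omega>. (X \<omega>)\<^sup>2) = v" for X
    using X(1,2)
  proof (cases rule: centered_gaussian_cases)
    case 1
    then show ?thesis using X(3) \<open>v > 0\<close> by simp
  next
    case (2 s)
    then have "s = \<sigma>" using X(3) by (simp add: \<sigma>_def)
    then show ?thesis
      using distributed_integral[OF 2(2), of "\<lambda>x. f x * x"] by (simp add: m_def D_def)
  qed
  ultimately show ?thesis using that by blast
qed

text \<open>
  The residuals \<open>Y i - \<beta> * Z i\<close> are orthogonal to all \<open>Z j\<close>, so their Gram matrix is that of \<open>Y\<close> minus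
  \<open>\<beta>\<^sup>2\<close> times that of \<open>Z\<close>; and every Gram matrix is positive semidefinite.
\<close>

lemma (in prob_space) uncorrelated_residual_domination:
  fixes Y Z :: "nat \<Rightarrow> 'a \<Rightarrow> real"
  assumes Y[measurable]: "\<And>i. Y i \<in> borel_measurable M" and Z[measurable]: "\<And>i. Z i \<in> borel_measurable M"
    and Y2: "\<And>i. integrable M (\<lambda>\<omega>. (Y i \<omega>)\<^sup>2)" and Z2: "\<And>i. integrable M (\<lambda>\<omega>. (Z i \<omega>)\<^sup>2)"
    and cross: "\<And>i j. expectation (\<lambda>\<omega>. Y i \<omega> * Z j \<omega>) = \<beta> * expectation (\<lambda>\<omega>. Z i \<omega> * Z j \<omega>)"
  shows "\<beta>\<^sup>2 * (\<Sum>i<n. \<Sum>j<n. v i * expectation (\<lambda>\<omega>. Z i \<omega> * Z j \<omega>) * v j)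
    \<le> (\<Sum>i<n. \<Sum>j<n. v i * expectation (\<lambda>\<omega>. Y i \<omega> * Y j \<omega>) * v j)"
proof -
  define U where "U i \<omega> = Y i \<omega> - \<beta> * Z i \<omega>" for i \<omega>
  note int = integrable_product_of_squares[OF Y Y Y2 Y2] integrable_product_of_squares[OF Z Z Z2 Z2]
    integrable_product_of_squares[OF Y Z Y2 Z2]
  have U_eq: "U i \<omega> * U j \<omega> = Y i \<omega> * Y j \<omega> - \<beta> * (Y i \<omega> * Z j \<omega>) - \<beta> * (Y j \<omega> * Z i \<omega>) + \<beta>\<^sup>2 * (Z i \<omega> * Z j \<omega>)"
    for i j \<omega> by (simp add: U_def power2_eq_square algebra_simps)
  have Ui: "integrable M (\<lambda>\<omega>. U i \<omega> * U j \<omega>)" for i j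
    unfolding U_eq using int by simp
  have EU: "expectation (\<lambda>\<omega>. U i \<omega> * U j \<omega>)
      = expectation (\<lambda>\<omega>. Y i \<omega> * Y j \<omega>) - \<beta>\<^sup>2 * expectation (\<lambda>\<omega>. Z i \<omega> * Z j \<omega>)" for i j
  proof -
    have "expectation (\<lambda>\<omega>. Z j \<omega> * Z i \<omega>) = expectation (\<lambda>\<omega>. Z i \<omega> * Z j \<omega>)"
      by (simp add: mult.commute)
    then show ?thesis
      unfolding U_eq using int cross[of i j] cross[of j i] by (simp add: power2_eq_square)
  qed
  have "0 \<le> expectation (\<lambda>\<omega>. (\<Sum>i<n. v i * U i \<omega>)\<^sup>2)" by simp
  also have "\<dots> = expectation (\<lambda>\<omega>. \<Sum>i<n. \<Sum>j<n. (v i * v j) * (U i \<omega> * U j \<omega>))"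
    by (simp add: power2_eq_square sum_product mult_ac)
  also have "\<dots> = (\<Sum>i<n. \<Sum>j<n. (v i * v j) * expectation (\<lambda>\<omega>. U i \<omega> * U j \<omega>))"
    using Ui by (simp add: Bochner_Integration.integral_sum)
  also have "\<dots> = (\<Sum>i<n. \<Sum>j<n. v i * expectation (\<lambda>\<omega>. Y i \<omega> * Y j \<omega>) * v j)
      - \<beta>\<^sup>2 * (\<Sum>i<n. \<Sum>j<n. v i * expectation (\<lambda>\<omega>. Z i \<omega> * Z j \<omega>) * v j)"
    unfolding EU sum_distrib_left sum_subtractf[symmetric]
    by (intro sum.cong refl) (simp add: algebra_simps)
  finally show ?thesis by simp
qed

section \<open>Decay of the inverse covariance matrix\<close>

lemma has_stationary_covariance_centered:
  assumes "zero_mean M Z" and "has_stationary_covariance M Z k"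
  shows "integral\<^sup>L M (\<lambda>\<omega>. Z x \<omega> * Z y \<omega>) = k (x - y)"
  using assms by (simp add: zero_mean_def has_stationary_covariance_def covariance_def)

theorem theorem1:
  fixes M :: "'w measure"
    and Z Y :: "real ^ 'd \<Rightarrow> 'w \<Rightarrow> real"
    and kZ kY :: "real ^ 'd \<Rightarrow> real"
    and T :: "real \<Rightarrow> real"
    and s :: "nat \<Rightarrow> real ^ 'd"
    and \<tau> :: real
  assumes "prob_space M"
    and "gaussian_process M Z"
    and "zero_mean M Z"
    and "has_stationary_covariance M Z kZ"
    and "subexp_asymp_pos kZ"
    and "subexp_nondecreasing T"
    and "\<And>x \<omega>. \<omega> \<in> space M \<Longrightarrow> Y x \<omega> = T (Z x \<omega>)"
    and "zero_mean M Y"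
    and "has_stationary_covariance M Y kY"
    and "well_separated s"
    and "\<tau> > 0"
  shows "\<exists>C. \<forall>n\<ge>1. \<exists>B. mat_inverse (cov_mat kY s n) = Some B \<and>
           (\<forall>i<n. \<forall>j<n. \<bar>B $$ (i, j)\<bar> \<le> C / (1 + infnorm (s i - s j) powr (real CARD('d) + \<tau>)))"
proof -
  interpret prob_space M by fact
  note covZ = has_stationary_covariance_centered[OF assms(3,4)]
  note covY = has_stationary_covariance_centered[OF assms(8,9)]
  note pair = gaussian_process_pair[OF assms(2-4)]
  note D = gaussian_pairD[OF pair]
  have YT: "integral\<^sup>L M (\<lambda>\<omega>. Y x \<omega> * h \<omega>) = integral\<^sup>L M (\<lambda>\<omega>. T (Z x \<omega>) * h \<omega>)" for x h
    using assms(7) by (intro Bochner_Integration.integral_cong) auto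
  obtain r where r: "r > 0" and sep: "\<And>i j. i \<noteq> j \<Longrightarrow> r \<le> infnorm (s i - s j)"
    using well_separatedD[OF assms(10)] by metis
  obtain Cz c where c: "c > 0" and kZ_decay: "\<And>u. \<bar>kZ u\<bar> \<le> Cz * exp (- c * infnorm u)"
    using assms(5) unfolding subexp_asymp_pos_def by blast
  obtain \<delta> where \<delta>: "\<delta> > 0" "\<And>n. n \<ge> 1 \<Longrightarrow> \<delta> \<le> smallest_eigenvalue (cov_mat kZ s n)"
    using assms(5,10) unfolding subexp_asymp_pos_def by blast
  have kZ_sym: "kZ (x - y) = kZ (y - x)" for x y
    unfolding covZ[symmetric] by (simp add: mult.commute)
  have kZ_form: "\<delta> * (\<Sum>i<n. (v i)\<^sup>2) \<le> (\<Sum>i<n. \<Sum>j<n. v i * kZ (s i - s j) * v j)" for n v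
  proof (cases "n \<ge> 1")
    case True
    have "\<delta> * (\<Sum>i<n. (v i)\<^sup>2) \<le> smallest_eigenvalue (cov_mat kZ s n) * (\<Sum>i<n. (v i)\<^sup>2)"
      using \<delta>(2)[OF True] by (intro mult_right_mono sum_nonneg) auto
    also have "\<dots> \<le> quad_form (cov_mat kZ s n) n v"
    proof (rule smallest_eigenvalue_le_quad_form[OF _ True])
      show "cov_mat kZ s n \<in> carrier_mat n n" by (simp add: cov_mat_def)
      show "cov_mat kZ s n $$ (i, j) = cov_mat kZ s n $$ (j, i)" if "i < n" "j < n" for i j
        using that kZ_sym by (simp add: cov_mat_def)
    qed
    finally show ?thesis by (simp add: quad_form_def cov_mat_def)
  next
    case False
    then have "n = 0" by simp
    then show ?thesis by simp
  qed
  define v where "v = kZ 0"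
  have v: "v > 0" using kZ_form[of "\<lambda>_. 1" 1] \<delta>(1) by (simp add: v_def)
  have var: "integral\<^sup>L M (\<lambda>\<omega>. (Z x \<omega>)\<^sup>2) = v" for x
    using covZ[of x x] by (simp add: v_def power2_eq_square)
  from assms(6) have T_diff: "T differentiable_on UNIV" and T_mono: "mono T"
    and T_nc: "\<not> T constant_on UNIV" by (auto simp: subexp_nondecreasing_def)
  from assms(6) obtain C where T_growth: "\<And>t. \<bar>T t\<bar> \<le> C * exp (C * \<bar>t\<bar>)"
    and T'_growth: "\<And>t. \<bar>deriv T t\<bar> \<le> C * exp (C * \<bar>t\<bar>)"
    unfolding subexp_nondecreasing_def by blast
  have T_cont: "continuous_on UNIV T" by (rule differentiable_imp_continuous_on[OF T_diff])
  have T_meas: "T \<in> borel_measurable borel" by (rule borel_measurable_continuous_onI[OF T_cont])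
  have T_mean: "integral\<^sup>L M (\<lambda>\<omega>. T (Z x \<omega>)) = 0" for x
    using assms(8) YT[of x "\<lambda>_. 1"] by (simp add: zero_mean_def)
  \<comment> \<open>\<open>m\<close> does not depend on the site, as all \<open>Z x\<close> have the same variance\<close>
  obtain m where m: "m > 0" and slope: "\<And>x. integral\<^sup>L M (\<lambda>\<omega>. T (Z x \<omega>) * Z x \<omega>) = m"
    using gaussian_transform_slope[OF v T_cont T_mono T_nc T_growth] D(2,6) var by metis
  define \<beta> where "\<beta> = m / v"
  have cross: "integral\<^sup>L M (\<lambda>\<omega>. Y x \<omega> * Z y \<omega>) = \<beta> * integral\<^sup>L M (\<lambda>\<omega>. Z x \<omega> * Z y \<omega>)" for x y
    unfolding YT using gaussian_transform_cross_covariance[OF pair _ T_meas T_growth, of x y] v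
    by (simp add: var slope \<beta>_def)
  have kY_form: "\<beta>\<^sup>2 * \<delta> * (\<Sum>i<n. (w i)\<^sup>2) \<le> (\<Sum>i<n. \<Sum>j<n. w i * kY (s i - s j) * w j)" for n w
  proof -
    have "\<beta>\<^sup>2 * \<delta> * (\<Sum>i<n. (w i)\<^sup>2) \<le> \<beta>\<^sup>2 * (\<Sum>i<n. \<Sum>j<n. w i * kZ (s i - s j) * w j)"
      using kZ_form[of w n] by (simp add: mult.assoc mult_left_mono)
    also have "\<dots> \<le> (\<Sum>i<n. \<Sum>j<n. w i * kY (s i - s j) * w j)"
      unfolding covZ[symmetric] covY[symmetric]
      by (rule uncorrelated_residual_domination)
        (use assms(4,9) cross in \<open>auto simp: has_stationary_covariance_def\<close>)
    finally show ?thesis .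
  qed
  define K where "K = C\<^sup>2 * (2 * exp ((2 * (2 * C + 1))\<^sup>2 * v / 2) + 2 * exp ((2 * C)\<^sup>2 * v / 2))"
  have K: "K \<ge> 0" by (simp add: K_def)
  have kY_decay: "\<bar>kY u\<bar> \<le> (Cz / v * K) * exp (- c * infnorm u)" for u
  proof -
    have "kY u = integral\<^sup>L M (\<lambda>\<omega>. T (Z u \<omega>) * T (Z 0 \<omega>))"
      using covY[of u 0] assms(7) by (simp cong: Bochner_Integration.integral_cong)
    also have "\<bar>\<dots>\<bar> \<le> \<bar>kZ u\<bar> / v * K"
      using gaussian_transform_covariance_bound[OF pair v var var T_meas T_growth
          increment_bound_if_exp_deriv[OF T_diff T'_growth] T_mean, of u 0]
      by (simp add: covZ K_def)
    also have "\<dots> \<le> (Cz * exp (- c * infnorm u)) / v * K"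
      using kZ_decay[of u] v K by (intro mult_right_mono divide_right_mono) auto
    finally show ?thesis by (simp add: mult_ac)
  qed
  \<comment> \<open>the decay of \<open>k\<^sub>Y\<close> and the positivity of its forms are all that the Combes-Thomas argument needs\<close>
  have pos: "\<beta>\<^sup>2 * \<delta> > 0" using m v \<delta>(1) by (simp add: \<beta>_def)
  obtain \<eta> where \<eta>: "\<eta> > 0" and inv: "\<And>n. \<exists>B. mat_inverse (cov_mat kY s n) = Some B
     \<and> (\<forall>i<n. \<forall>j<n. \<bar>B $$ (i, j)\<bar> \<le> 2 / (\<beta>\<^sup>2 * \<delta>) * exp (- \<eta> * infnorm (s i - s j)))"
    using inverse_decay[of r s c kY, OF r sep c kY_decay pos kY_form] unfolding cov_mat_def by metis
  define p where "p = real CARD('d) + \<tau>"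
  have p: "p > 0" using assms(11) by (simp add: p_def add_nonneg_pos)
  have "2 / (\<beta>\<^sup>2 * \<delta>) * exp (- \<eta> * t) \<le> 2 / (\<beta>\<^sup>2 * \<delta>) * (1 + (p / \<eta>) powr p) / (1 + t powr p)"
    if "t \<ge> 0" for t
    using mult_left_mono[OF exp_le_inverse_polynomial[OF p \<eta> that], of "2 / (\<beta>\<^sup>2 * \<delta>)"] pos by simp
  then have "\<forall>n\<ge>1. \<exists>B. mat_inverse (cov_mat kY s n) = Some B \<and>
      (\<forall>i<n. \<forall>j<n. \<bar>B $$ (i, j)\<bar> \<le> 2 / (\<beta>\<^sup>2 * \<delta>) * (1 + (p / \<eta>) powr p) / (1 + infnorm (s i - s j) powr p))"
    using inv order_trans infnorm_pos_le by meson
  then show ?thesis unfolding p_def by (rule exI)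
qed

end
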